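(* Let $G$ be an abelian group and $\mathbb{K}$ an algebraically closed field of characteristic zero. Let $R=A\otimes B$, where $A$ is an upper block-triangular matrix algebra over $\mathbb{K}$ with an elementary $G$-grading and $B$ is a $G$-graded division algebra over $\mathbb{K}$, and let $H=\mathrm{supp}\,B$. Let $t$ be the least integer such that $\mathrm{Cap}_t\in Id(A_e)$ and let $f=f(x_1,\dots,x_m)$ be an $A$-good polynomial. Let $h_1,\dots,h_u\in H$, let $S_1=\{y_1^{h_1},y_2^e,\dots,y_m^e\},\dots,S_u=\{z_1^{h_u},z_2^e,\dots,z_m^e\}$ be $u$ pairwise disjoint sets of variables, and let $$f^{h_1}=f(y_1^{h_1},y_2^e,\dots,y_m^e),\ \dots,\ f^{h_u}=f(z_1^{h_u},z_2^e,\dots,z_m^e).$$ A multilinear polynomial $g(x_1^{h_1},\dots,x_u^{h_u})\in\mathbb{K}\langle X_H\rangle$ is a graded identity for $B$ if and only if the multilinear polynomial $g(f^{h_1},\dots,f^{h_u})\mathrm{Cap}_{t-1}$ is a graded identity for $R=A\otimes B$.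
   Context: A $G$-grading on an algebra $A$ is a vector space decomposition $A=\bigoplus_{g\in G}A_g$ with $A_gA_h\subseteq A_{gh}$; $e$ is the identity of $G$, $A_e$ is the neutral component, and $\mathrm{supp}\,A=\{g\in G: A_g\neq0\}$. $UT(d_1,\dots,d_k)$ ($n=d_1+\cdots+d_k$) is the algebra of upper block-triangular matrices: the subalgebra of $M_n(\mathbb{K})$ of block matrices $(A_{ij})$, $A_{ij}$ of size $d_i\times d_j$, with $A_{ij}=0$ for $i>j$. An elementary grading on it is one induced by a tuple $(g_1,\dots,g_n)\in G^n$, with each matrix unit $e_{ij}$ in the algebra homogeneous of degree $g_ig_j^{-1}$. $A\otimes B$ is graded so that $(A\otimes B)_g$ is spanned by the $e_{ij}\otimes b$ with $b\in B$ homogeneous and $g_i(\deg_G b)g_j^{-1}=g$. A grading on a unital algebra $B$ is a division grading (and $B$ is a graded division algebra) if every nonzero homogeneous element is invertible. Convention: over the algebraically closed field $\mathbb{K}$ a graded division algebra is (isomorphic to) a twisted group algebra of its support; i.e. every nonzero homogeneous component is one-dimensional. $\mathbb{K}\langle X_G\rangle$ is the free $G$-graded associative algebra, with variables indexed by degree (superscript $g$ meaning degree $g$); a graded identity for a graded algebra $R$ is a polynomial vanishing under all substitutions of variables of degree $g$ by elements of $R_g$, for all $g$. $\mathbb{K}\langle X\rangle$ is the free associative algebra on the variables of degree $e$ (ordinary variables), and $Id(C)$ is the ideal of ordinary identities of $C$. $\mathrm{Cap}_t(x_1,\dots,x_t,y_1,\dots,y_{t+1})=\sum_{\sigma\in S_t}(\mathrm{sgn}\,\sigma)\,y_1x_{\sigma(1)}y_2x_{\sigma(2)}\cdots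 y_tx_{\sigma(t)}y_{t+1}$ is the Capelli polynomial of rank $t$, in variables of degree $e$. In the products $f\mathrm{Cap}_{t-1}$ and $g(f^{h_1},\dots,f^{h_u})\mathrm{Cap}_{t-1}$ the variables of $\mathrm{Cap}_{t-1}$ are disjoint from the variables of the other factor. $A$-good: for $A$ an upper block-triangular matrix algebra over $\mathbb{K}$ with an elementary $G$-grading and $t$ the least integer with $\mathrm{Cap}_t\in Id(A_e)$, a multilinear polynomial $f\in\mathbb{K}\langle X\rangle$ is $A$-good if $f\mathrm{Cap}_{t-1}$ is multilinear, $f\mathrm{Cap}_{t-1}$ is not a polynomial identity for $A_e$, and for every homomorphism $\varphi:\mathbb{K}\langle X\rangle\to A_e$ with $\varphi(f\mathrm{Cap}_{t-1})\neq0$ the element $\varphi(f)$ is in the center of $A_e$.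
   Formalization: The formal theorem also assumes supp A ∩ H = {e} (the usual normalisation); without it the claim fails, e.g. G={e,h}, A=M_2(K) with tuple (e,h), B=K[G], f=x_1, g=x_1x_2-x_2x_1 in degree e. *)

theory Defs
  imports
    "HOL-Analysis.Cartesian_Space"
    "HOL-Library.Poly_Mapping"
    "HOL-Computational_Algebra.Polynomial"
    "HOL-Combinatorics.Permutations"
begin

text \<open>
  The abelian group \<open>G\<close> is a type of class \<open>ab_group_add\<close>, hence written additively: its identity
  is \<open>0\<close>, and the product of \<open>g\<^sub>i\<close> with the inverse of \<open>g\<^sub>j\<close> is \<open>\<gamma> i - \<gamma> j\<close>.
\<close>

section \<open>Algebras and gradings\<close>

locale unital_algebra = vector_space scale
  for scale :: "'k::field \<Rightarrow> 'a::ab_group_add \<Rightarrow> 'a" +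
  fixes mul :: "'a \<Rightarrow> 'a \<Rightarrow> 'a" and one :: 'a
  assumes mul_assoc: "mul (mul x y) z = mul x (mul y z)"
    and mul_one_left: "mul one x = x"
    and mul_one_right: "mul x one = x"
    and mul_add_left: "mul (x + y) z = mul x z + mul y z"
    and mul_add_right: "mul x (y + z) = mul x y + mul x z"
    and mul_scale_left: "mul (scale c x) y = scale c (mul x y)"
    and mul_scale_right: "mul x (scale c y) = scale c (mul x y)"

abbreviation ring_algebra :: "('k::field \<Rightarrow> 'b::ring_1 \<Rightarrow> 'b) \<Rightarrow> bool" where
  "ring_algebra s \<equiv> unital_algebra s (*) 1"

definition supp :: "('g \<Rightarrow> 'a::zero set) \<Rightarrow> 'g set" where
  "supp \<Gamma> = {g. \<Gamma> g \<noteq> {0}}"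

definition is_grading :: "('k::field \<Rightarrow> 'b::ring_1 \<Rightarrow> 'b) \<Rightarrow> ('g::ab_group_add \<Rightarrow> 'b set) \<Rightarrow> bool" where
  "is_grading s \<Gamma> \<longleftrightarrow>
     (\<forall>g. module.subspace s (\<Gamma> g)) \<and>
     (\<forall>x. \<exists>!c. finite {g. c g \<noteq> 0} \<and> (\<forall>g. c g \<in> \<Gamma> g) \<and> x = (\<Sum>g | c g \<noteq> 0. c g)) \<and>
     (\<forall>g h. \<forall>x\<in>\<Gamma> g. \<forall>y\<in>\<Gamma> h. x * y \<in> \<Gamma> (g + h))"

definition graded_division_algebra ::
    "('k::field \<Rightarrow> 'b::ring_1 \<Rightarrow> 'b) \<Rightarrow> ('g::ab_group_add \<Rightarrow> 'b set) \<Rightarrow> bool" where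
  "graded_division_algebra s \<Gamma> \<longleftrightarrow>
     ring_algebra s \<and> is_grading s \<Gamma> \<and>
     (\<forall>g. \<forall>x\<in>\<Gamma> g. x \<noteq> 0 \<longrightarrow> (\<exists>y. x * y = 1 \<and> y * x = 1)) \<and>
     (\<forall>g\<in>supp \<Gamma>. vector_space.dim s (\<Gamma> g) = 1)"

section \<open>Free algebras and evaluation\<close>

datatype 'v free_monoid = Word (letters: "'v list")

instantiation free_monoid :: (type) monoid_add
begin

definition zero_free_monoid :: "'a free_monoid" where
  "zero_free_monoid = Word []"

definition plus_free_monoid :: "'a free_monoid \<Rightarrow> 'a free_monoid \<Rightarrow> 'a free_monoid" where
  "plus_free_monoid v w = Word (letters v @ letters w)"

instance
  by standard (simp_all add: zero_free_monoid_def plus_free_monoid_def)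

end

text \<open>
  The free algebra is the monoid algebra of the free monoid, with the multiplication that
  \<^theory>\<open>HOL-Library.Poly_Mapping\<close> provides. The pair \<open>(i, g)\<close> is the \<open>i\<close>-th variable of
  degree \<open>g\<close>.
\<close>

type_synonym ('v, 'k) free_algebra = "'v free_monoid \<Rightarrow>\<^sub>0 'k"
type_synonym ('g, 'k) graded_free_algebra = "(nat \<times> 'g, 'k) free_algebra"

definition Var :: "'v \<Rightarrow> ('v, 'k::field) free_algebra" where
  "Var x = Poly_Mapping.single (Word [x]) 1"

definition free_scale :: "'k \<Rightarrow> ('v, 'k::field) free_algebra \<Rightarrow> ('v, 'k) free_algebra" where
  "free_scale c p = Poly_Mapping.single 0 c * p"

definition vars :: "('v, 'k::field) free_algebra \<Rightarrow> 'v set" where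
  "vars p = (\<Union>w\<in>Poly_Mapping.keys p. set (letters w))"

definition ordinary_polys :: "('g::zero, 'k::field) graded_free_algebra set" where
  "ordinary_polys = {p. vars p \<subseteq> UNIV \<times> {0}}"

definition multilinear_in :: "'v set \<Rightarrow> ('v, 'k::field) free_algebra \<Rightarrow> bool" where
  "multilinear_in V p \<longleftrightarrow>
     finite V \<and> (\<forall>w\<in>Poly_Mapping.keys p. distinct (letters w) \<and> set (letters w) = V)"

definition multilinear :: "('v, 'k::field) free_algebra \<Rightarrow> bool" where
  "multilinear p \<longleftrightarrow> (\<exists>V. multilinear_in V p)"

definition monomial_value :: "('a \<Rightarrow> 'a \<Rightarrow> 'a) \<Rightarrow> 'a \<Rightarrow> ('v \<Rightarrow> 'a) \<Rightarrow> 'v free_monoid \<Rightarrow> 'a" where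
  "monomial_value mul one v w = foldr (\<lambda>x. mul (v x)) (letters w) one"

definition eval :: "('k::field \<Rightarrow> 'a::ab_group_add \<Rightarrow> 'a) \<Rightarrow> ('a \<Rightarrow> 'a \<Rightarrow> 'a) \<Rightarrow> 'a \<Rightarrow>
    ('v \<Rightarrow> 'a) \<Rightarrow> ('v, 'k) free_algebra \<Rightarrow> 'a" where
  "eval s mul one v p =
     (\<Sum>w\<in>Poly_Mapping.keys p. s (Poly_Mapping.lookup p w) (monomial_value mul one v w))"

abbreviation ring_eval ::
    "('k::field \<Rightarrow> 'b::ring_1 \<Rightarrow> 'b) \<Rightarrow> ('v \<Rightarrow> 'b) \<Rightarrow> ('v, 'k) free_algebra \<Rightarrow> 'b" where
  "ring_eval s \<equiv> eval s (*) 1"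

abbreviation subst :: "('v \<Rightarrow> ('w, 'k::field) free_algebra) \<Rightarrow> ('v, 'k) free_algebra \<Rightarrow>
    ('w, 'k) free_algebra" where
  "subst \<equiv> eval free_scale (*) 1"

text \<open>
  Evaluation at \<open>v\<close> is the algebra homomorphism from the free algebra that extends \<open>v\<close>.
\<close>

lemma free_algebra_induct [case_names single add]:
  assumes single: "\<And>w c. P (Poly_Mapping.single w c)"
    and add: "\<And>p q. P p \<Longrightarrow> P q \<Longrightarrow> P (p + q)"
  shows "P p"
proof (induction p rule: Poly_Mapping.update_induct)
  case const
  show ?case using single[of undefined 0] by simp
next
  case (update f a b)
  have "Poly_Mapping.update a b f = f + Poly_Mapping.single a b"
    using update(1)
    by (intro poly_mapping_eqI) (auto simp: lookup_update lookup_add lookup_single when_def in_keys_iff)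
  then show ?case
    using add[OF update(3) single] by simp
qed

lemma eval_sum_superset:
  assumes "unital_algebra s mul one" "finite W" "Poly_Mapping.keys p \<subseteq> W"
  shows "eval s mul one v p = (\<Sum>w\<in>W. s (Poly_Mapping.lookup p w) (monomial_value mul one v w))"
proof -
  interpret unital_algebra s mul one by fact
  show ?thesis
    unfolding eval_def using assms(2,3)
    by (intro sum.mono_neutral_left) (auto simp: in_keys_iff)
qed

lemma monomial_value_plus:
  assumes "unital_algebra s mul one"
  shows "monomial_value mul one v (w + w') =
    mul (monomial_value mul one v w) (monomial_value mul one v w')"
proof -
  interpret unital_algebra s mul one by fact
  have "foldr (\<lambda>x. mul (v x)) (xs @ ys) one =
      mul (foldr (\<lambda>x. mul (v x)) xs one) (foldr (\<lambda>x. mul (v x)) ys one)" for xs ys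
    by (induction xs) (simp_all add: mul_one_left mul_assoc)
  then show ?thesis
    by (simp add: monomial_value_def plus_free_monoid_def)
qed

lemma eval_single:
  assumes "unital_algebra s mul one"
  shows "eval s mul one v (Poly_Mapping.single w c) = s c (monomial_value mul one v w)"
  using eval_sum_superset[OF assms, of "{w}"] by simp

lemma eval_add:
  assumes "unital_algebra s mul one"
  shows "eval s mul one v (p + q) = eval s mul one v p + eval s mul one v q"
proof -
  interpret unital_algebra s mul one by fact
  let ?W = "Poly_Mapping.keys p \<union> Poly_Mapping.keys q"
  have "Poly_Mapping.keys (p + q) \<subseteq> ?W"
    by (rule Poly_Mapping.keys_add)
  then show ?thesis
    using eval_sum_superset[OF assms, of ?W]
    by (simp add: lookup_add scale_left_distrib sum.distrib)
qed

lemma eval_mult: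
  assumes "unital_algebra s mul one"
  shows "eval s mul one v (p * q) = mul (eval s mul one v p) (eval s mul one v q)"
proof -
  interpret unital_algebra s mul one by fact
  have zero: "mul 0 x = 0" "mul x 0 = 0" for x
    using mul_add_left[of 0 0 x] mul_add_right[of x 0 0] by auto
  have eval_0: "eval s mul one v 0 = 0"
    by (simp add: eval_def)
  have single: "eval s mul one v (Poly_Mapping.single w c * q) =
      mul (eval s mul one v (Poly_Mapping.single w c)) (eval s mul one v q)" for w c
    by (induction q rule: free_algebra_induct)
      (simp_all add: mult_single eval_single[OF assms] eval_add[OF assms] distrib_left
        monomial_value_plus[OF assms] mul_scale_left mul_scale_right mul_add_right mult.commute)
  show ?thesis
    by (induction p rule: free_algebra_induct)
      (simp_all add: single distrib_right eval_add[OF assms] mul_add_left)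
qed

lemma eval_one:
  assumes "unital_algebra s mul one"
  shows "eval s mul one v 1 = one"
proof -
  interpret unital_algebra s mul one by fact
  show ?thesis
    using eval_single[OF assms, of v 0 1]
    by (simp only: single_one) (simp add: monomial_value_def zero_free_monoid_def)
qed

lemma eval_free_scale:
  assumes "unital_algebra s mul one"
  shows "eval s mul one v (free_scale c p) = s c (eval s mul one v p)"
proof -
  interpret unital_algebra s mul one by fact
  show ?thesis
    by (simp add: free_scale_def eval_mult[OF assms] eval_single[OF assms] mul_scale_left
        mul_one_left monomial_value_def zero_free_monoid_def)
qed

lemma eval_Var:
  assumes "unital_algebra s mul one"
  shows "eval s mul one v (Var x) = v x"
proof -
  interpret unital_algebra s mul one by fact
  show ?thesis
    by (simp add: Var_def eval_single[OF assms] monomial_value_def mul_one_right)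
qed

lemma eval_unique:
  fixes \<phi> :: "('v, 'k::field) free_algebra \<Rightarrow> 'a::ab_group_add"
  assumes "unital_algebra s mul one"
    and add: "\<And>p q. \<phi> (p + q) = \<phi> p + \<phi> q"
    and mult: "\<And>p q. \<phi> (p * q) = mul (\<phi> p) (\<phi> q)"
    and one: "\<phi> 1 = one"
    and scale: "\<And>c p. \<phi> (free_scale c p) = s c (\<phi> p)"
  shows "\<phi> p = eval s mul one (\<lambda>x. \<phi> (Var x)) p"
proof -
  interpret A: unital_algebra s mul one by fact
  have word: "\<phi> (Poly_Mapping.single (Word xs) 1) = monomial_value mul one (\<lambda>x. \<phi> (Var x)) (Word xs)"
    for xs
  proof (induction xs)
    case Nil
    have "Poly_Mapping.single (Word []) 1 = (1 :: ('v, 'k) free_algebra)"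
      unfolding zero_free_monoid_def[symmetric] by (rule single_one)
    then show ?case
      using one by (simp add: monomial_value_def zero_free_monoid_def)
  next
    case (Cons x xs)
    have "Poly_Mapping.single (Word (x # xs)) (1 :: 'k) = Var x * Poly_Mapping.single (Word xs) 1"
      by (simp add: Var_def mult_single plus_free_monoid_def)
    then show ?case
      using Cons by (simp add: mult monomial_value_def)
  qed
  have single: "\<phi> (Poly_Mapping.single w c) =
      eval s mul one (\<lambda>x. \<phi> (Var x)) (Poly_Mapping.single w c)" for w c
  proof -
    have "Poly_Mapping.single w c = free_scale c (Poly_Mapping.single (Word (letters w)) 1)"
      by (simp add: free_scale_def mult_single)
    then show ?thesis
      using word[of "letters w"]
      by (simp add: scale eval_free_scale[OF assms(1)] eval_single[OF assms(1)] A.scale_one)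
  qed
  show ?thesis
    by (induction p rule: free_algebra_induct)
      (simp_all add: single add eval_add[OF assms(1)])
qed

text \<open>
  In the following two definitions \<open>ev\<close> is the evaluation map of the algebra in question.
\<close>

definition graded_identity ::
    "((nat \<times> 'g \<Rightarrow> 'a) \<Rightarrow> ('g, 'k::field) graded_free_algebra \<Rightarrow> 'a::zero) \<Rightarrow>
     ('g \<Rightarrow> 'a set) \<Rightarrow> ('g, 'k) graded_free_algebra \<Rightarrow> bool" where
  "graded_identity ev \<Gamma> p \<longleftrightarrow> (\<forall>v. (\<forall>i g. v (i, g) \<in> \<Gamma> g) \<longrightarrow> ev v p = 0)"

definition ordinary_identities ::
    "((nat \<times> 'g \<Rightarrow> 'a) \<Rightarrow> ('g::zero, 'k::field) graded_free_algebra \<Rightarrow> 'a::zero) \<Rightarrow>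
     'a set \<Rightarrow> ('g, 'k) graded_free_algebra set" where
  "ordinary_identities ev C = {p \<in> ordinary_polys. \<forall>v. (\<forall>x. v x \<in> C) \<longrightarrow> ev v p = 0}"

section \<open>Upper block-triangular matrices and the tensor product\<close>

text \<open>
  The positions \<open>1, \<dots>, n\<close> are the elements of the linearly ordered type \<open>'n\<close> in increasing
  order, so \<open>card {..<i}\<close> positions precede \<open>i\<close>.
\<close>

type_synonym ('a, 'n) sqmat = "(('a, 'n) vec, 'n) vec"

definition block_sizes :: "'n::finite itself \<Rightarrow> nat list \<Rightarrow> bool" where
  "block_sizes _ ds \<longleftrightarrow> (\<forall>d\<in>set ds. 0 < d) \<and> sum_list ds = CARD('n)"

definition block :: "nat list \<Rightarrow> 'n::{finite,linorder} \<Rightarrow> nat" where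
  "block ds i = (LEAST p. card {..<i} < sum_list (take (Suc p) ds))"

definition UT :: "nat list \<Rightarrow> ('k::field, 'n::{finite,linorder}) sqmat set" where
  "UT ds = {M. \<forall>i j. block ds j < block ds i \<longrightarrow> M $ i $ j = 0}"

definition munit :: "'n \<Rightarrow> 'n \<Rightarrow> ('k::field, 'n::finite) sqmat" where
  "munit i j = (\<chi> k l. if k = i \<and> l = j then 1 else 0)"

definition mat_scale :: "('k \<Rightarrow> 'b \<Rightarrow> 'b) \<Rightarrow> 'k \<Rightarrow> ('b, 'n::finite) sqmat \<Rightarrow> ('b, 'n) sqmat" where
  "mat_scale s c M = (\<chi> i j. s c (M $ i $ j))"

abbreviation mat_eval :: "('k::field \<Rightarrow> 'b::ring_1 \<Rightarrow> 'b) \<Rightarrow> ('v \<Rightarrow> ('b, 'n::finite) sqmat) \<Rightarrow>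
    ('v, 'k) free_algebra \<Rightarrow> ('b, 'n) sqmat" where
  "mat_eval s \<equiv> eval (mat_scale s) (**) (mat 1)"

definition elementary_grading ::
    "nat list \<Rightarrow> ('n::{finite,linorder} \<Rightarrow> 'g::ab_group_add) \<Rightarrow> 'g \<Rightarrow> ('k::field, 'n) sqmat set" where
  "elementary_grading ds \<gamma> a =
     module.span (mat_scale (*))
       {munit i j | i j. (munit i j :: ('k, 'n) sqmat) \<in> UT ds \<and> \<gamma> i - \<gamma> j = a}"

text \<open>
  The tensor product of \<open>UT ds\<close> with an algebra \<open>B\<close> is realised inside the matrices with
  entries in \<open>B\<close>, the tensor of \<open>a\<close> and \<open>b\<close> being the matrix with entries \<open>a\<^sub>i\<^sub>j b\<close>. The lemmas
  below show that this is the tensor product of algebras: it has the universal property, and the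
  product of two pure tensors is the tensor of the products.
\<close>

definition tensor ::
    "('k::field \<Rightarrow> 'b::ring_1 \<Rightarrow> 'b) \<Rightarrow> ('k, 'n::finite) sqmat \<Rightarrow> 'b \<Rightarrow> ('b, 'n) sqmat" where
  "tensor s a b = (\<chi> i j. s (a $ i $ j) b)"

definition UT_tensor ::
    "nat list \<Rightarrow> ('k::field \<Rightarrow> 'b::ring_1 \<Rightarrow> 'b) \<Rightarrow> ('b, 'n::{finite,linorder}) sqmat set" where
  "UT_tensor ds s =
     module.span (mat_scale s) {tensor s a b | a b. (a :: ('k, 'n) sqmat) \<in> UT ds}"

definition tensor_grading ::
    "nat list \<Rightarrow> ('n::{finite,linorder} \<Rightarrow> 'g::ab_group_add) \<Rightarrow>
     ('k::field \<Rightarrow> 'b::ring_1 \<Rightarrow> 'b) \<Rightarrow> ('g \<Rightarrow> 'b set) \<Rightarrow> 'g \<Rightarrow> ('b, 'n) sqmat set" where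
  "tensor_grading ds \<gamma> s \<Gamma> a =
     module.span (mat_scale s)
       {tensor s (munit i j) b | i j b d.
          (munit i j :: ('k, 'n) sqmat) \<in> UT ds \<and> b \<in> \<Gamma> d \<and> \<gamma> i + d - \<gamma> j = a}"

lemma ring_algebra_field: "ring_algebra ((*) :: 'k::field \<Rightarrow> 'k \<Rightarrow> 'k)"
  by unfold_locales (simp_all add: algebra_simps)

lemma unital_algebra_mat:
  fixes s :: "'a::field \<Rightarrow> 'b::ring_1 \<Rightarrow> 'b"
  assumes "ring_algebra s"
  shows "unital_algebra (mat_scale s) (**) (mat 1 :: ('b, 'n::finite) sqmat)"
proof -
  interpret B: unital_algebra s "(*)" "1 :: 'b" by fact
  show ?thesis
  proof (unfold_locales)
    fix M N P :: "('b, 'n) sqmat" and c c' :: 'a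
    show "mat_scale s c (M + N) = mat_scale s c M + mat_scale s c N"
      "mat_scale s (c + c') M = mat_scale s c M + mat_scale s c' M"
      "mat_scale s c (mat_scale s c' M) = mat_scale s (c * c') M"
      "mat_scale s 1 M = M"
      by (simp_all add: mat_scale_def vec_eq_iff B.scale_right_distrib B.scale_left_distrib)
    show "M ** N ** P = M ** (N ** P)"
      by (rule matrix_mul_assoc[symmetric])
    show "mat 1 ** M = M" "M ** mat 1 = M"
      by (rule matrix_mul_lid matrix_mul_rid)+
    show "(M + N) ** P = M ** P + N ** P" "M ** (N + P) = M ** N + M ** P"
      by (simp_all add: matrix_matrix_mult_def vec_eq_iff sum.distrib distrib_left distrib_right)
    show "mat_scale s c M ** N = mat_scale s c (M ** N)" "M ** mat_scale s c N = mat_scale s c (M ** N)"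
      by (simp_all add: matrix_matrix_mult_def mat_scale_def vec_eq_iff B.mul_scale_left
          B.mul_scale_right B.scale_sum_right)
  qed
qed

lemma tensor_algebra:
  assumes "ring_algebra s"
  shows "tensor s (a ** a') (b * b') = tensor s a b ** tensor s a' b'"
    and "tensor s (mat 1) 1 = mat 1"
proof -
  interpret B: unital_algebra s "(*)" 1 by fact
  show "tensor s (a ** a') (b * b') = tensor s a b ** tensor s a' b'"
    by (simp add: tensor_def vec_eq_iff matrix_matrix_mult_def B.scale_sum_left
        B.mul_scale_left B.mul_scale_right mult.commute)
  show "tensor s (mat 1) 1 = mat 1"
    by (simp add: tensor_def mat_def vec_eq_iff)
qed

lemma tensor_bilinear:
  assumes "ring_algebra s"
  shows "tensor s (a + a') b = tensor s a b + tensor s a' b"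
    and "tensor s a (b + b') = tensor s a b + tensor s a b'"
    and "tensor s (mat_scale (*) c a) b = mat_scale s c (tensor s a b)"
    and "tensor s a (s c b) = mat_scale s c (tensor s a b)"
proof -
  interpret B: unital_algebra s "(*)" 1 by fact
  show "tensor s (a + a') b = tensor s a b + tensor s a' b"
    and "tensor s a (b + b') = tensor s a b + tensor s a b'"
    and "tensor s (mat_scale (*) c a) b = mat_scale s c (tensor s a b)"
    and "tensor s a (s c b) = mat_scale s c (tensor s a b)"
    by (simp_all add: tensor_def mat_scale_def vec_eq_iff B.scale_left_distrib
        B.scale_right_distrib mult.commute)
qed

lemma UT_munit_sum:
  fixes a :: "('k::field, 'n::{finite,linorder}) sqmat"
  assumes "a \<in> UT ds"
  shows "a = (\<Sum>(i, j) | (munit i j :: ('k, 'n) sqmat) \<in> UT ds. mat_scale (*) (a $ i $ j) (munit i j))"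
proof -
  have UT: "(munit i j :: ('k, 'n) sqmat) \<in> UT ds \<longleftrightarrow> \<not> block ds j < block ds i" for i j
    by (auto simp: UT_def munit_def)
  have "(\<Sum>(i, j) | (munit i j :: ('k, 'n) sqmat) \<in> UT ds. mat_scale (*) (a $ i $ j) (munit i j)) $ k $ l
      = a $ k $ l" for k l
  proof -
    have "(\<Sum>(i, j) | (munit i j :: ('k, 'n) sqmat) \<in> UT ds. mat_scale (*) (a $ i $ j) (munit i j)) $ k $ l
      = (\<Sum>p | (munit (fst p) (snd p) :: ('k, 'n) sqmat) \<in> UT ds. if p = (k, l) then a $ k $ l else 0)"
      unfolding sum_component
      by (rule sum.cong) (auto simp: mat_scale_def munit_def split: if_splits)
    also have "\<dots> = a $ k $ l"
      using assms unfolding UT by (subst sum.delta) (auto simp: UT_def)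
    finally show ?thesis .
  qed
  then show ?thesis by (simp add: vec_eq_iff)
qed

lemma tensor_universal:
  fixes \<beta> :: "('k::field, 'n::{finite,linorder}) sqmat \<Rightarrow> 'b::ring_1 \<Rightarrow> 'v::ab_group_add"
  assumes B: "ring_algebra s" and V: "vector_space r"
    and add_left: "\<And>a a' b. a \<in> UT ds \<Longrightarrow> a' \<in> UT ds \<Longrightarrow> \<beta> (a + a') b = \<beta> a b + \<beta> a' b"
    and add_right: "\<And>a b b'. a \<in> UT ds \<Longrightarrow> \<beta> a (b + b') = \<beta> a b + \<beta> a b'"
    and scale_left: "\<And>a b c. a \<in> UT ds \<Longrightarrow> \<beta> (mat_scale (*) c a) b = r c (\<beta> a b)"
    and scale_right: "\<And>a b c. a \<in> UT ds \<Longrightarrow> \<beta> a (s c b) = r c (\<beta> a b)"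
  shows "\<exists>L. Vector_Spaces.linear (mat_scale s) r L \<and> (\<forall>a\<in>UT ds. \<forall>b. L (tensor s a b) = \<beta> a b)"
    and "\<lbrakk>Vector_Spaces.linear (mat_scale s) r L; Vector_Spaces.linear (mat_scale s) r L';
          \<forall>a\<in>UT ds. \<forall>b. L (tensor s a b) = \<beta> a b; \<forall>a\<in>UT ds. \<forall>b. L' (tensor s a b) = \<beta> a b;
          M \<in> UT_tensor ds s\<rbrakk> \<Longrightarrow> L M = L' M"
proof -
  interpret B: unital_algebra s "(*)" 1 by fact
  interpret V: vector_space r by fact
  interpret M: unital_algebra "mat_scale s" "(**)" "mat 1 :: ('b, 'n) sqmat"
    by (rule unital_algebra_mat) fact
  define E where "E = {(i, j). (munit i j :: ('k, 'n) sqmat) \<in> UT ds}"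
  define L where "L M = (\<Sum>(i, j)\<in>E. \<beta> (munit i j) (M $ i $ j))" for M :: "('b, 'n) sqmat"
  have UT_0: "(0 :: ('k, 'n) sqmat) \<in> UT ds"
    and UT_add: "\<And>a a' :: ('k, 'n) sqmat. a \<in> UT ds \<Longrightarrow> a' \<in> UT ds \<Longrightarrow> a + a' \<in> UT ds"
    and UT_scale: "\<And>c. \<And>a :: ('k, 'n) sqmat. a \<in> UT ds \<Longrightarrow> mat_scale (*) c a \<in> UT ds"
    by (auto simp: UT_def mat_scale_def)
  have beta_0: "\<beta> 0 b = 0" for b
    using add_left[OF UT_0 UT_0, of b] by simp
  have sum_left: "(\<Sum>p\<in>F. f p) \<in> UT ds \<and> \<beta> (\<Sum>p\<in>F. f p) b = (\<Sum>p\<in>F. \<beta> (f p) b)"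
    if "finite F" "\<And>p. p \<in> F \<Longrightarrow> f p \<in> UT ds" for F and f :: "'n \<times> 'n \<Rightarrow> ('k, 'n) sqmat" and b
    using that by (induction F rule: finite_induct) (auto simp: UT_0 beta_0 UT_add add_left)
  have "Vector_Spaces.linear (mat_scale s) r L"
  proof (unfold_locales)
    show "L (M + N) = L M + L N" for M N
      unfolding L_def sum.distrib[symmetric]
      by (rule sum.cong) (auto simp: E_def add_right)
    show "L (mat_scale s c M) = r c (L M)" for c M
      unfolding L_def V.scale_sum_right
      by (rule sum.cong) (auto simp: E_def scale_right mat_scale_def)
  qed
  moreover have "L (tensor s a b) = \<beta> a b" if a: "a \<in> UT ds" for a b
  proof -
    have "L (tensor s a b) = (\<Sum>(i, j)\<in>E. \<beta> (mat_scale (*) (a $ i $ j) (munit i j)) b)"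
      unfolding L_def
      by (rule sum.cong) (auto simp: E_def tensor_def scale_left scale_right)
    also have "\<dots> = \<beta> (\<Sum>(i, j)\<in>E. mat_scale (*) (a $ i $ j) (munit i j)) b"
      using sum_left[of E "\<lambda>(i, j). mat_scale (*) (a $ i $ j) (munit i j)" b]
      by (auto simp: E_def UT_scale split_def)
    also have "\<dots> = \<beta> a b"
      using UT_munit_sum[OF a] by (simp add: E_def split_def)
    finally show ?thesis .
  qed
  ultimately show "\<exists>L. Vector_Spaces.linear (mat_scale s) r L \<and>
      (\<forall>a\<in>UT ds. \<forall>b. L (tensor s a b) = \<beta> a b)"
    by blast
  show "L M = L' M"
    if "Vector_Spaces.linear (mat_scale s) r L" "Vector_Spaces.linear (mat_scale s) r L'"
      "\<forall>a\<in>UT ds. \<forall>b. L (tensor s a b) = \<beta> a b" "\<forall>a\<in>UT ds. \<forall>b. L' (tensor s a b) = \<beta> a b"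
      "M \<in> UT_tensor ds s" for L L' and M :: "('b, 'n) sqmat"
  proof -
    interpret P: vector_space_pair "mat_scale s :: 'k \<Rightarrow> ('b, 'n) sqmat \<Rightarrow> ('b, 'n) sqmat" r ..
    show ?thesis
      by (rule P.linear_eq_on_span[OF that(1,2), of "{tensor s a b | a b. a \<in> UT ds}"])
        (use that(3-5) in \<open>auto simp: UT_tensor_def\<close>)
  qed
qed

section \<open>Capelli polynomials and good polynomials\<close>

text \<open>
  The alternating variables are \<open>x 1, \<dots>, x t\<close> and the others are \<open>y 1, \<dots>, y (t + 1)\<close>, all of
  degree \<open>0\<close>; \<open>x\<close> and \<open>y\<close> give their indices.
\<close>

definition capelli ::
    "nat \<Rightarrow> (nat \<Rightarrow> nat) \<Rightarrow> (nat \<Rightarrow> nat) \<Rightarrow> ('g::zero, 'k::field) graded_free_algebra" where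
  "capelli t x y =
     (\<Sum>\<sigma> | \<sigma> permutes {1..t}.
        of_int (sign \<sigma>) *
        (\<Prod>i\<leftarrow>[1..<Suc t]. Var (y i, 0) * Var (x (\<sigma> i), 0)) * Var (y (Suc t), 0))"

definition capelli_fresh ::
    "nat \<Rightarrow> (nat \<Rightarrow> nat) \<Rightarrow> (nat \<Rightarrow> nat) \<Rightarrow> (nat \<times> 'g::zero) set \<Rightarrow> bool" where
  "capelli_fresh t x y V \<longleftrightarrow>
     inj_on x {1..t} \<and> inj_on y {1..Suc t} \<and> x ` {1..t} \<inter> y ` {1..Suc t} = {} \<and>
     ((x ` {1..t} \<union> y ` {1..Suc t}) \<times> {0}) \<inter> V = {}"

abbreviation neutral_component ::
    "nat list \<Rightarrow> ('n::{finite,linorder} \<Rightarrow> 'g::ab_group_add) \<Rightarrow> ('k::field, 'n) sqmat set" where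
  "neutral_component ds \<gamma> \<equiv> elementary_grading ds \<gamma> 0"

abbreviation neutral_identities ::
    "nat list \<Rightarrow> ('n::{finite,linorder} \<Rightarrow> 'g::ab_group_add) \<Rightarrow> ('g, 'k::field) graded_free_algebra set" where
  "neutral_identities ds \<gamma> \<equiv>
     ordinary_identities (mat_eval ((*) :: 'k \<Rightarrow> 'k \<Rightarrow> 'k)) (neutral_component ds \<gamma>)"

definition capelli_rank ::
    "'k::field itself \<Rightarrow> nat list \<Rightarrow> ('n::{finite,linorder} \<Rightarrow> 'g::ab_group_add) \<Rightarrow> nat" where
  "capelli_rank _ ds \<gamma> =
     (LEAST t. (capelli t (\<lambda>i. 2 * i) (\<lambda>i. 2 * i + 1) :: ('g, 'k) graded_free_algebra)
        \<in> neutral_identities ds \<gamma>)"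

definition center :: "('k::field, 'n::finite) sqmat set \<Rightarrow> ('k, 'n) sqmat set" where
  "center C = {z \<in> C. \<forall>a\<in>C. a ** z = z ** a}"

text \<open>
  The homomorphisms from the algebra of ordinary polynomials to the neutral component are the
  evaluations at families of elements of the neutral component.
\<close>

definition A_good ::
    "nat list \<Rightarrow> ('n::{finite,linorder} \<Rightarrow> 'g::ab_group_add) \<Rightarrow> ('g, 'k::field) graded_free_algebra \<Rightarrow> bool" where
  "A_good ds \<gamma> f \<longleftrightarrow>
     f \<in> ordinary_polys \<and> multilinear f \<and>
     (\<exists>x y. let t = capelli_rank TYPE('k) ds \<gamma>; F = f * capelli (t - 1) x y in
        capelli_fresh (t - 1) x y (vars f) \<and>
        multilinear F \<and>
        F \<notin> neutral_identities ds \<gamma> \<and>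
        (\<forall>v. (\<forall>x. v x \<in> neutral_component ds \<gamma>) \<longrightarrow> mat_eval (*) v F \<noteq> 0 \<longrightarrow>
           mat_eval (*) v f \<in> center (neutral_component ds \<gamma>)))"

text \<open>
  A pitfall in comparing the identities of a graded division algebra \<open>B\<close> with support \<open>H\<close> with those
  of \<open>A \<otimes> B\<close>: the decomposition has to be normalised by \<open>supp A \<inter> H = {0}\<close>, that is,
  \<open>\<gamma> i = \<gamma> j\<close> whenever \<open>\<gamma> i - \<gamma> j \<in> H\<close>; then the component of \<open>A \<otimes> B\<close> of degree \<open>h \<in> H\<close>
  is \<open>A\<^sub>0 \<otimes> B\<^sub>h\<close>. Replacing every \<open>\<gamma> i\<close> by a representative of its coset modulo \<open>H\<close> achieves this and
  does not change the graded algebra \<open>A \<otimes> B\<close> up to isomorphism, but it does change \<open>A\<^sub>0\<close>.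
  Without the normalisation, take \<open>G = {0, h}\<close> of order two, \<open>A = M\<^sub>2\<close> graded by the tuple
  \<open>(0, h)\<close>, and \<open>B\<close> the group algebra of \<open>G\<close>. Then \<open>A\<^sub>0\<close> is the diagonal, so the least Capelli rank
  is \<open>t = 2\<close> and \<open>f = x\<^sub>1\<close> is good; the polynomial \<open>x\<^sub>1 x\<^sub>2 - x\<^sub>2 x\<^sub>1\<close> in variables of
  degree \<open>0\<close> is a graded identity of \<open>B\<close>, but its product with the Capelli polynomial of rank
  \<open>1\<close> is none of \<open>A \<otimes> B\<close>, whose neutral component is isomorphic to \<open>M\<^sub>2\<close>.
\<close>

end

theory Submission
  imports Defs "HOL-Library.Multiset"
begin

text \<open>
  Since \<open>supp A \<inter> H = {0}\<close> and \<open>H\<close> is a subgroup, the component of \<open>A \<otimes> B\<close> of degree \<open>h \<in> H\<close> is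
  \<open>A\<^sub>0 \<otimes> \<beta>\<^sub>h\<close> with \<open>\<beta>\<^sub>h\<close> spanning \<open>B\<^sub>h\<close>. Hence \<open>f\<^sup>h\<close> takes values \<open>a \<otimes> \<beta>\<^sub>h\<close> with \<open>a\<close> a value of \<open>f\<close> on
  \<open>A\<^sub>0\<close>, and the Capelli polynomial takes values \<open>C \<otimes> 1\<close>. If \<open>a C = 0\<close> for one of the values \<open>a\<close>
  of \<open>f\<close> involved, then every monomial of \<open>g\<close> contributes zero, since by goodness the values
  \<open>a'\<close> with \<open>a' C \<noteq> 0\<close> are central and can be moved out of the way. Otherwise all the values of
  \<open>f\<close> are central, and the product is \<open>D \<otimes> g(\<beta>)\<close> with \<open>D\<close> independent of the monomial. Conversely,
  take values \<open>z\<close> of \<open>f\<close> and \<open>C\<close> of the Capelli polynomial with \<open>z C \<noteq> 0\<close>. The central element \<open>z\<close> is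
  diagonal, so \<open>z\<^sup>u C \<noteq> 0\<close>, and \<open>z\<^sup>u C \<otimes> g(b)\<close> is a value of the product for all homogeneous \<open>b\<close>.
\<close>

section \<open>Evaluations in free algebras\<close>

text \<open>Constants are supported on the empty word and therefore commute with every polynomial.
  Substitution thus becomes evaluation in an algebra, and the evaluation lemmas apply to
  \<open>subst\<close>.\<close>

lemma unital_algebra_free:
  "unital_algebra free_scale (*) (1 :: ('v, 'k::field) free_algebra)"
proof -
  have comm: "p * Poly_Mapping.single 0 c = Poly_Mapping.single 0 c * p"
    for p :: "('v, 'k) free_algebra" and c
    by (induction p rule: free_algebra_induct)
      (simp_all add: mult_single distrib_left distrib_right mult.commute)
  show ?thesis
  proof unfold_locales
    fix p q :: "('v, 'k) free_algebra" and c d :: 'k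
    show "free_scale c (p + q) = free_scale c p + free_scale c q"
      "free_scale (c + d) p = free_scale c p + free_scale d p"
      by (simp_all add: free_scale_def distrib_left distrib_right single_add)
    show "free_scale c (free_scale d p) = free_scale (c * d) p"
      by (simp add: free_scale_def mult_single flip: mult.assoc)
    show "free_scale c p * q = free_scale c (p * q)"
      by (simp add: free_scale_def mult.assoc)
    show "p * free_scale c q = free_scale c (p * q)"
      unfolding free_scale_def by (metis comm mult.assoc)
  qed (simp_all add: free_scale_def distrib_left distrib_right mult.assoc)
qed

text \<open>Both sides are algebra homomorphisms in \<open>p\<close> with the same values on
  variables.\<close>

lemma eval_subst:
  assumes "unital_algebra s mul one"
  shows "eval s mul one v (subst \<theta> p) = eval s mul one (\<lambda>x. eval s mul one v (\<theta> x)) p"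
  using eval_unique[OF assms, of "\<lambda>p. eval s mul one v (subst \<theta> p)" p]
  by (simp add: eval_add[OF assms] eval_mult[OF assms] eval_one[OF assms] eval_free_scale[OF assms]
      eval_add[OF unital_algebra_free] eval_mult[OF unital_algebra_free]
      eval_one[OF unital_algebra_free] eval_free_scale[OF unital_algebra_free]
      eval_Var[OF unital_algebra_free])

lemma monomial_value_cong:
  assumes "\<And>x. x \<in> set (letters w) \<Longrightarrow> v x = v' x"
  shows "monomial_value mul one v w = monomial_value mul one v' w"
  unfolding monomial_value_def by (rule foldr_cong) (simp_all add: assms)

lemma eval_cong:
  assumes "\<And>x. x \<in> vars p \<Longrightarrow> v x = v' x"
  shows "eval s mul one v p = eval s mul one v' p"
  unfolding eval_def
  by (rule sum.cong) (auto intro!: arg_cong[of _ _ "s _"] monomial_value_cong assms simp: vars_def)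

lemma eval_sum:
  assumes "unital_algebra s mul one"
  shows "eval s mul one v (\<Sum>i\<in>I. p i) = (\<Sum>i\<in>I. eval s mul one v (p i))"
  by (induction I rule: infinite_finite_induct)
    (auto simp: eval_add[OF assms] eval_def[of _ _ _ _ 0])

lemma eval_prod_list_cong:
  assumes "unital_algebra s mul one"
    and "\<And>i. i \<in> set is \<Longrightarrow> eval s mul one v (p i) = eval s mul one v' (p' i)"
  shows "eval s mul one v (\<Prod>i\<leftarrow>is. p i) = eval s mul one v' (\<Prod>i\<leftarrow>is. p' i)"
  using assms(2)
  by (induction "is") (simp_all add: eval_one[OF assms(1)] eval_mult[OF assms(1)])

lemma of_int_free_algebra:
  "(of_int n :: ('v, 'k::field) free_algebra) = free_scale (of_int n) 1"
  unfolding free_scale_def mult_1_right by (rule single_of_int[symmetric])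

text \<open>The two sides may use different variable names: only the sequences of substituted
  elements matter. This moves Capelli values between the variables fixed by goodness and those of
  the theorem.\<close>

lemma eval_capelli_cong:
  assumes "unital_algebra s mul one"
    and "\<And>i. i \<in> {1..t} \<Longrightarrow> v (x i, 0) = v' (x' i, 0)"
    and "\<And>i. i \<in> {1..Suc t} \<Longrightarrow> v (y i, 0) = v' (y' i, 0)"
  shows "eval s mul one v (capelli t x y) = eval s mul one v' (capelli t x' y')"
  unfolding capelli_def eval_sum[OF assms(1)]
proof (rule sum.cong)
  fix \<sigma> assume "\<sigma> \<in> {\<sigma>. \<sigma> permutes {1..t}}"
  then have \<sigma>: "\<sigma> i \<in> {1..t}" if "i \<in> {1..t}" for i
    using that by (simp only: mem_Collect_eq permutes_in_image)
  have prod: "eval s mul one v (\<Prod>i\<leftarrow>[1..<Suc t]. Var (y i, 0) * Var (x (\<sigma> i), 0)) =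
      eval s mul one v' (\<Prod>i\<leftarrow>[1..<Suc t]. Var (y' i, 0) * Var (x' (\<sigma> i), 0))"
  proof (rule eval_prod_list_cong[OF assms(1)])
    fix i assume "i \<in> set [1..<Suc t]"
    then have i: "i \<in> {1..t}" by auto
    then have "i \<in> {1..Suc t}" by simp
    then show "eval s mul one v (Var (y i, 0) * Var (x (\<sigma> i), 0)) =
        eval s mul one v' (Var (y' i, 0) * Var (x' (\<sigma> i), 0))"
      by (simp only: eval_mult[OF assms(1)] eval_Var[OF assms(1)] assms(2)[OF \<sigma>[OF i]] assms(3))
  qed
  have y: "v (y (Suc t), 0) = v' (y' (Suc t), 0)"
    by (rule assms(3)) simp
  show "eval s mul one v (of_int (sign \<sigma>) *
      (\<Prod>i\<leftarrow>[1..<Suc t]. Var (y i, 0) * Var (x (\<sigma> i), 0)) * Var (y (Suc t), 0)) =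
    eval s mul one v' (of_int (sign \<sigma>) *
      (\<Prod>i\<leftarrow>[1..<Suc t]. Var (y' i, 0) * Var (x' (\<sigma> i), 0)) * Var (y' (Suc t), 0))"
    unfolding eval_mult[OF assms(1)] prod eval_Var[OF assms(1)] y of_int_free_algebra
      eval_free_scale[OF assms(1)] eval_one[OF assms(1)] ..
qed simp

section \<open>Variables and ordinary polynomials\<close>

lemma vars_add: "vars (p + q) \<subseteq> vars p \<union> vars q"
  unfolding vars_def using Poly_Mapping.keys_add[of p q] by blast

lemma vars_mult: "vars (p * q) \<subseteq> vars p \<union> vars q"
proof
  fix x assume "x \<in> vars (p * q)"
  then obtain w where w: "w \<in> Poly_Mapping.keys (p * q)" "x \<in> set (letters w)"
    by (auto simp: vars_def)
  then obtain a b where "w = a + b" "a \<in> Poly_Mapping.keys p" "b \<in> Poly_Mapping.keys q"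
    using keys_mult[of p q] by blast
  then show "x \<in> vars p \<union> vars q"
    using w(2) by (auto simp: vars_def plus_free_monoid_def)
qed

lemma ordinary_polys_add:
  "p \<in> ordinary_polys \<Longrightarrow> q \<in> ordinary_polys \<Longrightarrow> p + q \<in> ordinary_polys"
  unfolding ordinary_polys_def using vars_add[of p q] by blast

lemma ordinary_polys_mult:
  "p \<in> ordinary_polys \<Longrightarrow> q \<in> ordinary_polys \<Longrightarrow> p * q \<in> ordinary_polys"
  unfolding ordinary_polys_def using vars_mult[of p q] by blast

lemma ordinary_polys_single:
  "set (letters w) \<subseteq> UNIV \<times> {0} \<Longrightarrow> Poly_Mapping.single w c \<in> ordinary_polys"
  by (auto simp: ordinary_polys_def vars_def split: if_splits)

text \<open>Membership in \<open>ordinary_identities\<close> includes membership in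
  \<open>ordinary_polys\<close>, so this fact helps to turn a non-identity into a nonzero
  value.\<close>

lemma capelli_ordinary: "capelli t x y \<in> ordinary_polys"
proof -
  have one: "1 \<in> (ordinary_polys :: ('g::zero, 'k::field) graded_free_algebra set)"
    unfolding single_one[symmetric] by (rule ordinary_polys_single) (simp add: zero_free_monoid_def)
  have of_int: "of_int n \<in> (ordinary_polys :: ('g::zero, 'k::field) graded_free_algebra set)" for n
    unfolding single_of_int[symmetric]
    by (rule ordinary_polys_single) (simp add: zero_free_monoid_def)
  have Var: "Var (i, 0) \<in> (ordinary_polys :: ('g::zero, 'k::field) graded_free_algebra set)" for i
    unfolding Var_def by (rule ordinary_polys_single) simp
  have prod: "(\<And>i. p i \<in> ordinary_polys) \<Longrightarrow> (\<Prod>i\<leftarrow>is. p i) \<in> ordinary_polys"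
    for p :: "nat \<Rightarrow> ('g::zero, 'k::field) graded_free_algebra" and "is"
    by (induction "is") (auto simp: one ordinary_polys_mult)
  have sum: "(\<And>i. p i \<in> ordinary_polys) \<Longrightarrow> (\<Sum>i\<in>I. p i) \<in> ordinary_polys"
    for p :: "'i \<Rightarrow> ('g::zero, 'k::field) graded_free_algebra" and I
    by (induction I rule: infinite_finite_induct)
      (simp_all add: ordinary_polys_add, simp_all add: ordinary_polys_def vars_def)
  show ?thesis
    unfolding capelli_def by (intro sum ordinary_polys_mult of_int prod Var)
qed

section \<open>The neutral component and evaluations at tensors\<close>

lemma munit_in_UT: "(munit i j :: ('k::field, 'n::{finite,linorder}) sqmat) \<in> UT ds \<longleftrightarrow>
    block ds i \<le> block ds j"
  by (auto simp: UT_def munit_def not_less[symmetric])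

text \<open>The entrywise condition cuts out a subspace containing the spanning matrix units, and a
  matrix that satisfies it is the combination of those units given by its own entries.\<close>

lemma elementary_grading_iff:
  fixes M :: "('k::field, 'n::{finite,linorder}) sqmat"
  shows "M \<in> elementary_grading ds \<gamma> a \<longleftrightarrow>
    (\<forall>i j. M $ i $ j \<noteq> 0 \<longrightarrow> block ds i \<le> block ds j \<and> \<gamma> i - \<gamma> j = a)" (is "_ \<longleftrightarrow> ?P M")
proof -
  interpret A: unital_algebra "mat_scale (*)" "(**)" "mat 1 :: ('k, 'n) sqmat"
    by (rule unital_algebra_mat[OF ring_algebra_field])
  let ?E = "{munit i j | i j. (munit i j :: ('k, 'n) sqmat) \<in> UT ds \<and> \<gamma> i - \<gamma> j = a}"
  have "?E \<subseteq> Collect ?P"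
    by (auto simp: munit_in_UT) (auto simp: munit_def split: if_splits)
  moreover have "A.subspace (Collect ?P)"
    unfolding A.subspace_def by (auto simp: mat_scale_def) (metis add_0)+
  ultimately have "A.span ?E \<subseteq> Collect ?P"
    by (rule A.span_minimal)
  moreover have "M \<in> A.span ?E" if M: "?P M"
  proof -
    have "M \<in> UT ds"
      using M by (fastforce simp: UT_def)
    then have "M = (\<Sum>(i, j) | (munit i j :: ('k, 'n) sqmat) \<in> UT ds.
        mat_scale (*) (M $ i $ j) (munit i j))"
      by (rule UT_munit_sum)
    also have "\<dots> \<in> A.span ?E"
    proof (intro A.span_sum, clarify)
      fix i j assume ij: "(munit i j :: ('k, 'n) sqmat) \<in> UT ds"
      show "mat_scale (*) (M $ i $ j) (munit i j) \<in> A.span ?E"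
      proof (cases "M $ i $ j = 0")
        case True
        then show ?thesis
          by (simp add: A.span_zero)
      next
        case False
        then show ?thesis
          using M ij by (intro A.span_scale A.span_base) blast
      qed
    qed
    finally show ?thesis .
  qed
  ultimately show ?thesis
    unfolding elementary_grading_def by blast
qed

lemma neutral_component_mult:
  assumes "M \<in> neutral_component ds \<gamma>" "N \<in> neutral_component ds \<gamma>"
  shows "M ** N \<in> neutral_component ds \<gamma>"
  unfolding elementary_grading_iff
proof (intro allI impI)
  fix i j assume "(M ** N) $ i $ j \<noteq> 0"
  then obtain k where "M $ i $ k * N $ k $ j \<noteq> 0"
    by (auto simp: matrix_matrix_mult_def elim: sum.not_neutral_contains_not_neutral)
  then have "M $ i $ k \<noteq> 0" "N $ k $ j \<noteq> 0" by auto
  then show "block ds i \<le> block ds j \<and> \<gamma> i - \<gamma> j = 0"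
    using assms unfolding elementary_grading_iff by fastforce
qed

lemma neutral_component_mat_1: "mat 1 \<in> neutral_component ds \<gamma>"
  by (simp add: elementary_grading_iff mat_def)

lemma monomial_value_neutral_component:
  assumes "\<And>x. x \<in> set (letters w) \<Longrightarrow> v x \<in> neutral_component ds \<gamma>"
  shows "monomial_value (**) (mat 1) v w \<in> neutral_component ds \<gamma>"
proof -
  have "foldr (\<lambda>x. (**) (v x)) xs (mat 1) \<in> neutral_component ds \<gamma>"
    if "\<And>x. x \<in> set xs \<Longrightarrow> v x \<in> neutral_component ds \<gamma>" for xs
    using that by (induction xs) (auto intro: neutral_component_mult neutral_component_mat_1)
  then show ?thesis
    using assms by (simp add: monomial_value_def)
qed

lemma eval_neutral_component:
  fixes v :: "'v \<Rightarrow> ('k::field, 'n::{finite,linorder}) sqmat"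
  assumes "\<And>x. x \<in> vars p \<Longrightarrow> v x \<in> neutral_component ds \<gamma>"
  shows "mat_eval (*) v p \<in> neutral_component ds \<gamma>"
proof -
  interpret A: unital_algebra "mat_scale (*)" "(**)" "mat 1 :: ('k, 'n) sqmat"
    by (rule unital_algebra_mat[OF ring_algebra_field])
  have "A.subspace (neutral_component ds \<gamma>)"
    unfolding elementary_grading_def by simp
  then show ?thesis
    unfolding eval_def
    by (intro A.subspace_sum A.subspace_scale)
      (auto intro!: monomial_value_neutral_component assms simp: vars_def)
qed

text \<open>The idempotents \<open>munit i i\<close> have degree
  \<open>\<gamma> i - \<gamma> i = 0\<close>, and a matrix commuting with all of them has no
  off-diagonal entry.\<close>

lemma center_neutral_component_diagonal:
  fixes z :: "('k::field, 'n::{finite,linorder}) sqmat"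
  assumes "z \<in> center (neutral_component ds \<gamma>)" "i \<noteq> j"
  shows "z $ i $ j = 0"
proof -
  have "munit i i \<in> (neutral_component ds \<gamma> :: ('k, 'n) sqmat set)"
    by (auto simp: elementary_grading_iff munit_def)
  then have "munit i i ** z = z ** munit i i"
    using assms by (simp add: center_def)
  then have "(munit i i ** z) $ i $ j = (z ** munit i i) $ i $ j" by simp
  then show ?thesis
    using assms(2) by (simp add: matrix_matrix_mult_def munit_def if_distrib[of "\<lambda>c. c * _"] cong: if_cong)
qed

text \<open>Left multiplication by a diagonal matrix scales rows. Since powers of nonzero scalars
  are nonzero, further factors \<open>z\<close> cannot kill a nonzero entry of
  \<open>z ** C\<close>.\<close>

lemma monomial_value_diagonal:
  fixes z :: "('k::field, 'n::finite) sqmat"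
  assumes "\<And>i j. i \<noteq> j \<Longrightarrow> z $ i $ j = 0"
    and "\<And>x. x \<in> set (letters w) \<Longrightarrow> v x = z"
  shows "(monomial_value (**) (mat 1) v w ** M) $ i $ j = z $ i $ i ^ length (letters w) * M $ i $ j"
proof -
  have diag: "(z ** N) $ i $ j = z $ i $ i * N $ i $ j" for N
  proof -
    have "(z ** N) $ i $ j = (\<Sum>k\<in>{i}. z $ i $ k * N $ k $ j)"
      unfolding matrix_matrix_mult_def using assms(1)
      by (simp only: vec_lambda_beta) (rule sum.mono_neutral_right, auto)
    then show ?thesis by simp
  qed
  have "(foldr (\<lambda>x. (**) (v x)) xs (mat 1) ** M) $ i $ j = z $ i $ i ^ length xs * M $ i $ j"
    if "\<And>x. x \<in> set xs \<Longrightarrow> v x = z" for xs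
    using that by (induction xs) (simp_all add: diag flip: matrix_mul_assoc)
  then show ?thesis
    using assms(2) by (simp add: monomial_value_def)
qed

text \<open>The words have the same multiset of letters, and composing commuting maps depends on
  nothing else.\<close>

lemma monomial_value_commuting:
  assumes "unital_algebra s mul one"
    and "\<And>x y. x \<in> V \<Longrightarrow> y \<in> V \<Longrightarrow> mul (v x) (v y) = mul (v y) (v x)"
    and "distinct (letters w)" "set (letters w) = V" "distinct (letters w')" "set (letters w') = V"
  shows "monomial_value mul one v w = monomial_value mul one v w'"
proof -
  interpret unital_algebra s mul one by fact
  \<comment> \<open>The words are reversed because \<open>foldr\<close> along a list is
    \<open>fold\<close> along its reversal.\<close>
  have "mset (rev (letters w)) = mset (rev (letters w'))"
    using assms(3-) by (metis mset_rev set_eq_iff_mset_eq_distinct)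
  then have "fold (\<lambda>x. mul (v x)) (rev (letters w)) = fold (\<lambda>x. mul (v x)) (rev (letters w'))"
    using assms(2,4) by (intro fold_multiset_equiv) (auto simp: fun_eq_iff simp flip: mul_assoc)
  then show ?thesis
    by (simp add: monomial_value_def foldr_conv_fold)
qed

text \<open>
  The central factors are moved to the left until a factor that annihilates \<open>C\<close> stands next to it.
\<close>

lemma monomial_value_annihilates:
  fixes C :: "('k::field, 'n::{finite,linorder}) sqmat"
  assumes "\<And>x. x \<in> set (letters w) \<Longrightarrow> v x \<in> neutral_component ds \<gamma>"
    and "\<And>x. x \<in> set (letters w) \<Longrightarrow> v x ** C = 0 \<or> v x \<in> center (neutral_component ds \<gamma>)"
    and "z \<in> set (letters w)" "v z ** C = 0"
  shows "monomial_value (**) (mat 1) v w ** C = 0"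
proof -
  interpret A: unital_algebra "mat_scale (*)" "(**)" "mat 1 :: ('k, 'n) sqmat"
    by (rule unital_algebra_mat[OF ring_algebra_field])
  have zero: "M ** 0 = 0" for M :: "('k, 'n) sqmat"
    by (simp add: matrix_matrix_mult_def vec_eq_iff)
  have "monomial_value (**) (mat 1) v (Word xs) ** C = 0"
    if "\<And>x. x \<in> set xs \<Longrightarrow> v x \<in> neutral_component ds \<gamma>"
      and "\<And>x. x \<in> set xs \<Longrightarrow> v x ** C = 0 \<or> v x \<in> center (neutral_component ds \<gamma>)"
      and "z \<in> set xs" for xs
    using that
  \<comment> \<open>Letters are split off at the right end, next to \<open>C\<close>.\<close>
  proof (induction xs rule: rev_induct)
    case (snoc x xs)
    let ?m = "monomial_value (**) (mat 1) v (Word xs)"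
    have "monomial_value (**) (mat 1) v (Word (xs @ [x])) =
        ?m ** monomial_value (**) (mat 1) v (Word [x])"
      using monomial_value_plus[OF A.unital_algebra_axioms, of v "Word xs" "Word [x]"]
      by (simp add: plus_free_monoid_def)
    then have split: "monomial_value (**) (mat 1) v (Word (xs @ [x])) ** C = ?m ** v x ** C"
      by (simp add: monomial_value_def)
    show ?case
    proof (cases "v x ** C = 0")
      case True
      then show ?thesis
        unfolding split by (simp add: zero flip: matrix_mul_assoc)
    next
      case False
      \<comment> \<open>The letter \<open>x\<close> differs from \<open>z\<close>; being central,
        its value passes to the left of the remaining product.\<close>
      then have "z \<in> set xs" and x: "v x \<in> center (neutral_component ds \<gamma>)"
        using snoc.prems(2)[of x] snoc.prems(3) assms(4) by auto
      then have "?m ** C = 0"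
        using snoc by simp
      moreover have "?m \<in> neutral_component ds \<gamma>"
        using snoc.prems(1) by (intro monomial_value_neutral_component) auto
      then have "?m ** v x = v x ** ?m"
        using x by (simp add: center_def)
      ultimately show ?thesis
        unfolding split by (simp add: zero flip: matrix_mul_assoc)
    qed
  qed simp
  from this[of "letters w"] show ?thesis
    using assms by simp
qed

section \<open>Evaluation at pure tensors\<close>

lemma monomial_value_tensor:
  assumes "ring_algebra s"
  shows "monomial_value (**) (mat 1) (\<lambda>x. tensor s (a x) (b x)) w =
    tensor s (monomial_value (**) (mat 1) a w) (monomial_value (*) 1 b w)"
proof -
  have "foldr (\<lambda>x. (**) (tensor s (a x) (b x))) xs (mat 1) =
      tensor s (foldr (\<lambda>x. (**) (a x)) xs (mat 1)) (foldr (\<lambda>x. (*) (b x)) xs 1)" for xs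
    by (induction xs) (simp_all add: tensor_algebra[OF assms])
  then show ?thesis
    by (simp add: monomial_value_def)
qed

lemma tensor_sum_left:
  assumes "ring_algebra s"
  shows "tensor s (\<Sum>i\<in>I. a i) b = (\<Sum>i\<in>I. tensor s (a i) b)"
proof -
  interpret B: unital_algebra s "(*)" 1 by fact
  show ?thesis
    by (simp add: tensor_def vec_eq_iff B.scale_sum_left)
qed

lemma tensor_sum_right:
  assumes "ring_algebra s"
  shows "tensor s a (\<Sum>i\<in>I. b i) = (\<Sum>i\<in>I. tensor s a (b i))"
proof -
  interpret B: unital_algebra s "(*)" 1 by fact
  show ?thesis
    by (simp add: tensor_def vec_eq_iff B.scale_sum_right)
qed

text \<open>Serves for polynomials whose monomials all agree in the second factor: \<open>f\<close>
  with one distinguished variable, and the Capelli polynomial. The common value leaves the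
  sum.\<close>

lemma eval_tensor_constant_right:
  assumes "ring_algebra s"
    and "\<And>x. x \<in> vars p \<Longrightarrow> v x = tensor s (a x) (b x)"
    and "\<And>w. w \<in> Poly_Mapping.keys p \<Longrightarrow> monomial_value (*) 1 b w = c"
  shows "mat_eval s v p = tensor s (mat_eval (*) a p) c"
proof -
  have "mat_eval s v p = mat_eval s (\<lambda>x. tensor s (a x) (b x)) p"
    by (rule eval_cong) (rule assms(2))
  then show ?thesis
    unfolding eval_def tensor_sum_left[OF assms(1)]
    by (simp add: monomial_value_tensor[OF assms(1)] assms(3) tensor_bilinear[OF assms(1)])
qed

text \<open>The core of the transfer: after multiplication by \<open>C\<close> the first factor no
  longer depends on the monomial, so the remaining sum over monomials is the value of
  \<open>p\<close> in the second factor.\<close>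

lemma eval_tensor_constant_left:
  fixes v :: "'v \<Rightarrow> ('b::ring_1, 'n::finite) sqmat"
  assumes B: "ring_algebra s"
    and "\<And>x. x \<in> vars p \<Longrightarrow> v x = tensor s (a x) (b x)"
    and "\<And>w. w \<in> Poly_Mapping.keys p \<Longrightarrow> monomial_value (**) (mat 1) a w ** C = D"
  shows "mat_eval s v p ** tensor s C 1 = tensor s D (ring_eval s b p)"
proof -
  interpret M: unital_algebra "mat_scale s" "(**)" "mat 1"
    by (rule unital_algebra_mat) fact
  have sum: "(\<Sum>i\<in>I. M i) ** N = (\<Sum>i\<in>I. M i ** N)" for I N and M :: "'i \<Rightarrow> ('b, 'n) sqmat"
    by (simp add: matrix_matrix_mult_def vec_eq_iff sum_distrib_right sum.swap[of _ UNIV])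
  have mul: "tensor s a' b' ** tensor s C 1 = tensor s (a' ** C) b'" for a' b'
    using tensor_algebra(1)[OF B, of a' C b' 1] by simp
  have "mat_eval s v p = mat_eval s (\<lambda>x. tensor s (a x) (b x)) p"
    by (rule eval_cong) (rule assms(2))
  note eq = this
  show ?thesis
    unfolding eq unfolding eval_def tensor_sum_right[OF B] sum
    by (simp add: monomial_value_tensor[OF B] tensor_bilinear[OF B] M.mul_scale_left assms(3) mul)
qed

section \<open>Graded division algebras and the tensor grading\<close>

lemma graded_division_algebra_line:
  assumes "graded_division_algebra s \<Gamma>" "d \<in> supp \<Gamma>"
  obtains \<beta> where "\<beta> \<in> \<Gamma> d" "\<And>b. b \<in> \<Gamma> d \<Longrightarrow> \<exists>c. b = s c \<beta>"
proof -
  interpret B: unital_algebra s "(*)" 1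
    using assms(1) by (simp add: graded_division_algebra_def)
  have "B.dim (\<Gamma> d) = 1"
    using assms by (simp add: graded_division_algebra_def)
  then obtain X where X: "X \<subseteq> \<Gamma> d" "\<Gamma> d \<subseteq> B.span X" "card X = 1"
    using B.basis_exists[of "\<Gamma> d"] by metis
  then obtain \<beta> where "X = {\<beta>}"
    by (auto simp: card_1_singleton_iff)
  then show ?thesis
    using X that[of \<beta>] by (auto simp: B.span_singleton)
qed

text \<open>Invertibility alone does not place the inverse of \<open>\<beta>\<close> in a component.
  Instead, \<open>\<beta> * \<beta>\<close> is a multiple of \<open>\<beta>\<close>, and cancelling
  \<open>\<beta>\<close> makes it a nonzero multiple of 1.\<close>

lemma graded_division_algebra_one:
  assumes "graded_division_algebra s \<Gamma>" "0 \<in> supp \<Gamma>"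
  shows "1 \<in> \<Gamma> 0"
proof -
  interpret B: unital_algebra s "(*)" 1
    using assms(1) by (simp add: graded_division_algebra_def)
  have sub: "B.subspace (\<Gamma> 0)" and mul: "\<And>a b. a \<in> \<Gamma> 0 \<Longrightarrow> b \<in> \<Gamma> 0 \<Longrightarrow> a * b \<in> \<Gamma> (0 + 0)"
    using assms(1) by (simp_all only: graded_division_algebra_def is_grading_def)
  obtain \<beta> where \<beta>: "\<beta> \<in> \<Gamma> 0" "\<And>b. b \<in> \<Gamma> 0 \<Longrightarrow> \<exists>c. b = s c \<beta>"
    using graded_division_algebra_line[OF assms] by blast
  have "\<beta> \<noteq> 0"
    using \<beta> assms(2) B.subspace_0[OF sub] by (auto simp: supp_def)
  then obtain y where y: "\<beta> * y = 1" "y * \<beta> = 1"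
    using assms(1) \<beta>(1) unfolding graded_division_algebra_def by blast
  obtain c where c: "\<beta> * \<beta> = s c \<beta>"
    using \<beta>(2) mul[OF \<beta>(1) \<beta>(1)] by auto
  have "\<beta> = (\<beta> * \<beta>) * y"
    by (simp add: mult.assoc y)
  also have "\<dots> = s c 1"
    by (simp add: c B.mul_scale_left y)
  finally have eq: "\<beta> = s c 1" .
  then have "c \<noteq> 0"
    using \<open>\<beta> \<noteq> 0\<close> by auto
  then have "1 = s (inverse c) \<beta>"
    by (simp add: eq)
  then show ?thesis
    using B.subspace_scale[OF sub \<beta>(1), of "inverse c"] by simp
qed

text \<open>The inverse \<open>y\<close> of \<open>b\<close> is split into components. Since 1 is
  homogeneous of degree 0, uniqueness of its decomposition forces \<open>y\<close> to have a nonzero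
  component of degree \<open>- d\<close>; multiplying it by \<open>a\<close> gives a nonzero element
  of degree \<open>g - d\<close>.\<close>

lemma graded_division_algebra_supp_diff:
  fixes s :: "'k::field \<Rightarrow> 'b::ring_1 \<Rightarrow> 'b" and \<Gamma> :: "'g::ab_group_add \<Rightarrow> 'b set"
  assumes "graded_division_algebra s \<Gamma>" "0 \<in> supp \<Gamma>" "g \<in> supp \<Gamma>" "d \<in> supp \<Gamma>"
  shows "g - d \<in> supp \<Gamma>"
proof -
  interpret B: unital_algebra s "(*)" 1
    using assms(1) by (simp add: graded_division_algebra_def)
  have sub: "\<And>g. B.subspace (\<Gamma> g)"
    and dec: "\<And>x. \<exists>!c. finite {g. c g \<noteq> 0} \<and> (\<forall>g. c g \<in> \<Gamma> g) \<and> x = (\<Sum>g | c g \<noteq> 0. c g)"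
    and mul: "\<And>g h a b. a \<in> \<Gamma> g \<Longrightarrow> b \<in> \<Gamma> h \<Longrightarrow> a * b \<in> \<Gamma> (g + h)"
    using assms(1) by (simp_all only: graded_division_algebra_def is_grading_def)
  have nonzero: "\<exists>b\<in>\<Gamma> e. b \<noteq> 0" if "e \<in> supp \<Gamma>" for e
    using that B.subspace_0[OF sub[of e]] by (auto simp: supp_def)
  obtain a b where a: "a \<in> \<Gamma> g" "a \<noteq> 0" and b: "b \<in> \<Gamma> d" "b \<noteq> 0"
    using nonzero[OF assms(3)] nonzero[OF assms(4)] by blast
  have inv: "\<exists>y. x * y = 1 \<and> y * x = 1" if "x \<in> \<Gamma> e" "x \<noteq> 0" for x e
    using assms(1) that unfolding graded_division_algebra_def by blast
  obtain y where y: "b * y = 1"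
    using inv[OF b] by blast
  obtain c where c: "finite {g. c g \<noteq> 0}" "\<And>g. c g \<in> \<Gamma> g" "y = (\<Sum>g | c g \<noteq> 0. c g)"
    using dec[of y] by blast
  \<comment> \<open>\<open>c' e\<close> is the part of \<open>b * y = 1\<close> in degree
    \<open>e\<close>; a left inverse of \<open>b\<close> shows that no component is lost.\<close>
  define c' where "c' e = b * c (e - d)" for e
  have nz: "c' e \<noteq> 0 \<longleftrightarrow> c (e - d) \<noteq> 0" for e
  proof -
    obtain z where "z * b = 1"
      using inv[OF b] by blast
    then have "z * (b * c (e - d)) = c (e - d)"
      by (simp flip: mult.assoc)
    then show ?thesis
      unfolding c'_def by (metis mult_zero_right)
  qed
  have bij: "bij_betw (\<lambda>e. e + d) {g. c g \<noteq> 0} {g. c' g \<noteq> 0}"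
    by (rule bij_betwI[where g = "\<lambda>e. e - d"]) (auto simp: nz)
  have "1 = (\<Sum>g | c g \<noteq> 0. c' (g + d))"
    by (simp add: c'_def flip: y sum_distrib_left c(3))
  also have "\<dots> = (\<Sum>g | c' g \<noteq> 0. c' g)"
    by (rule sum.reindex_bij_betw[OF bij])
  finally have sum: "1 = (\<Sum>g | c' g \<noteq> 0. c' g)" .
  have c'_in: "c' e \<in> \<Gamma> e" for e
    using mul[OF b(1) c(2)[of "e - d"]] by (simp add: c'_def)
  have "finite {g. c' g \<noteq> 0}"
    using bij c(1) by (simp add: bij_betw_finite)
  then have 1: "finite {g. c' g \<noteq> 0} \<and> (\<forall>g. c' g \<in> \<Gamma> g) \<and> 1 = (\<Sum>g | c' g \<noteq> 0. c' g)"
    using sum c'_in by blast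
  \<comment> \<open>The second decomposition of 1, concentrated in degree 0.\<close>
  define e :: "'g \<Rightarrow> 'b" where "e g = (if g = 0 then 1 else 0)" for g
  have "(1::'b) \<noteq> 0"
    using b(2) by (metis mult_1_right mult_zero_right)
  then have "{g. e g \<noteq> 0} = {0}"
    by (auto simp: e_def)
  then have "finite {g. e g \<noteq> 0} \<and> (\<forall>g. e g \<in> \<Gamma> g) \<and> 1 = (\<Sum>g | e g \<noteq> 0. e g)"
    using graded_division_algebra_one[OF assms(1,2)] B.subspace_0[OF sub] by (auto simp: e_def)
  then have "c' = e"
    using 1 dec[of 1] by blast
  then have "c' 0 \<noteq> 0"
    using \<open>(1::'b) \<noteq> 0\<close> by (simp add: e_def)
  then have "c (- d) \<noteq> 0"
    by (simp add: nz)
  obtain z where z: "z * a = 1"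
    using inv[OF a] by blast
  have "z * (a * c (- d)) = c (- d)"
    using z by (simp flip: mult.assoc)
  then have "a * c (- d) \<noteq> 0"
    using \<open>c (- d) \<noteq> 0\<close> by auto
  moreover have "a * c (- d) \<in> \<Gamma> (g - d)"
    using mul[OF a(1) c(2)[of "- d"]] by simp
  ultimately show ?thesis
    by (auto simp: supp_def)
qed

section \<open>Homogeneous components of the tensor product\<close>

lemma tensor_in_tensor_grading:
  fixes a :: "('k::field, 'n::{finite,linorder}) sqmat" and s :: "'k \<Rightarrow> 'b::ring_1 \<Rightarrow> 'b"
  assumes B: "ring_algebra s" and "a \<in> neutral_component ds \<gamma>" "b \<in> \<Gamma> d"
  shows "tensor s a b \<in> tensor_grading ds \<gamma> s \<Gamma> d"
proof -
  interpret A: unital_algebra "mat_scale (*)" "(**)" "mat 1 :: ('k, 'n) sqmat"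
    by (rule unital_algebra_mat[OF ring_algebra_field])
  interpret B: unital_algebra s "(*)" 1 by fact
  interpret M: unital_algebra "mat_scale s" "(**)" "mat 1 :: ('b, 'n) sqmat"
    by (rule unital_algebra_mat) fact
  have zero: "tensor s (0 :: ('k, 'n) sqmat) b = 0"
    by (simp add: tensor_def vec_eq_iff)
  show ?thesis
    using assms(2) unfolding elementary_grading_def
  proof (induction rule: A.span_induct_alt)
    case base
    then show ?case
      unfolding zero tensor_grading_def by (rule M.span_zero)
  next
    case (step c u a)
    then have "\<gamma> i + d - \<gamma> j = d" if "\<gamma> i = \<gamma> j" for i j
      using that by simp
    then have "tensor s u b \<in> tensor_grading ds \<gamma> s \<Gamma> d"
      using step(1) assms(3) unfolding tensor_grading_def
      by (intro M.span_base) fastforce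
    then show ?case
      using step(2) unfolding tensor_bilinear[OF B] tensor_grading_def
      by (intro M.span_add M.span_scale)
  qed
qed

text \<open>The normalisation enters here. If a generator of degree \<open>h\<close> has second
  factor \<open>b \<noteq> 0\<close> of degree \<open>d\<close>, then
  \<open>\<gamma> i - \<gamma> j = h - d\<close> lies in the supports of both gradings, hence is 0,
  and \<open>d = h\<close>.\<close>

lemma tensor_grading_supp:
  fixes \<gamma> :: "'n::{finite,linorder} \<Rightarrow> 'g::ab_group_add" and s :: "'k::field \<Rightarrow> 'b::ring_1 \<Rightarrow> 'b"
  assumes D: "graded_division_algebra s \<Gamma>"
    and norm: "supp (elementary_grading ds \<gamma> :: 'g \<Rightarrow> ('k, 'n) sqmat set) \<inter> supp \<Gamma> = {0}"
    and h: "h \<in> supp \<Gamma>" and \<beta>: "\<And>b. b \<in> \<Gamma> h \<Longrightarrow> \<exists>c. b = s c \<beta>"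
    and M: "M \<in> tensor_grading ds \<gamma> s \<Gamma> h"
  obtains a where "a \<in> neutral_component ds \<gamma>" "M = tensor s a \<beta>"
proof -
  interpret A: unital_algebra "mat_scale (*)" "(**)" "mat 1 :: ('k, 'n) sqmat"
    by (rule unital_algebra_mat[OF ring_algebra_field])
  have B: "ring_algebra s"
    using D by (simp add: graded_division_algebra_def)
  interpret B: unital_algebra s "(*)" 1 by fact
  interpret M: unital_algebra "mat_scale s" "(**)" "mat 1 :: ('b, 'n) sqmat"
    by (rule unital_algebra_mat) fact
  let ?N = "neutral_component ds \<gamma> :: ('k, 'n) sqmat set"
  have sub: "A.subspace ?N"
    unfolding elementary_grading_def by simp
  have zero: "tensor s (0 :: ('k, 'n) sqmat) b = 0" "tensor s (a :: ('k, 'n) sqmat) 0 = 0" for a b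
    by (simp_all add: tensor_def vec_eq_iff)
  have "M \<in> (\<lambda>a. tensor s a \<beta>) ` ?N"
    using M unfolding tensor_grading_def
  proof (induction rule: M.span_induct_alt)
    case base
    then show ?case
      using A.subspace_0[OF sub] zero(1) by (metis imageI)
  next
    case (step c u M)
    then obtain i j b d where u: "u = tensor s (munit i j) b"
        and ij: "(munit i j :: ('k, 'n) sqmat) \<in> UT ds"
        and b: "b \<in> \<Gamma> d" and deg: "\<gamma> i + d - \<gamma> j = h"
      by blast
    from step obtain a where a: "a \<in> ?N" "M = tensor s a \<beta>"
      by blast
    show ?case
    \<comment> \<open>A zero \<open>b\<close> lies in every component and says nothing about
      \<open>d\<close>.\<close>
    proof (cases "b = 0")
      case True
      then show ?thesis
        using a by (simp add: u zero)
    next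
      case False
      have "munit i j \<in> (elementary_grading ds \<gamma> (\<gamma> i - \<gamma> j) :: ('k, 'n) sqmat set)"
        unfolding elementary_grading_def using ij by (intro A.span_base) blast
      moreover have "(munit i j :: ('k, 'n) sqmat) \<noteq> 0"
        by (auto simp: munit_def vec_eq_iff)
      ultimately have "\<gamma> i - \<gamma> j \<in> supp (elementary_grading ds \<gamma> :: 'g \<Rightarrow> ('k, 'n) sqmat set)"
        by (auto simp: supp_def)
      moreover have "d \<in> supp \<Gamma>"
        using b False by (auto simp: supp_def)
      then have "h - d \<in> supp \<Gamma>"
        using graded_division_algebra_supp_diff[OF D _ h] norm by blast
      moreover have "h - d = \<gamma> i - \<gamma> j"
        using deg by (simp add: algebra_simps)
      ultimately have "\<gamma> i - \<gamma> j \<in> {0}"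
        unfolding norm[symmetric] by simp
      then have 0: "\<gamma> i - \<gamma> j = 0"
        by simp
      then have "d = h"
        using deg by (simp add: algebra_simps)
      then obtain c' where c': "b = s c' \<beta>"
        using \<beta> b by blast
      have "munit i j \<in> ?N"
        unfolding elementary_grading_def using ij 0 by (intro A.span_base) blast
      then have "mat_scale (*) c (mat_scale (*) c' (munit i j)) + a \<in> ?N"
        using a(1) by (intro A.subspace_add[OF sub] A.subspace_scale[OF sub])
      moreover have "mat_scale s c u + M =
          tensor s (mat_scale (*) c (mat_scale (*) c' (munit i j)) + a) \<beta>"
        unfolding u c' a(2) tensor_bilinear[OF B] ..
      ultimately show ?thesis
        by blast
    qed
  qed
  then show ?thesis
    using that by blast
qed

section \<open>Good polynomials\<close>

text \<open>Supplies the values of \<open>f\<close> and of the Capelli polynomial from which the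
  converse direction starts.\<close>

lemma A_good_witness:
  fixes f :: "('g::ab_group_add, 'k::field) graded_free_algebra"
    and \<gamma> :: "'n::{finite,linorder} \<Rightarrow> 'g"
  assumes "A_good ds \<gamma> f"
  defines "C \<equiv> capelli (capelli_rank TYPE('k) ds \<gamma> - 1) :: _ \<Rightarrow> _ \<Rightarrow> ('g, 'k) graded_free_algebra"
  shows "\<exists>v x y. (\<forall>z. v z \<in> (neutral_component ds \<gamma> :: ('k, 'n) sqmat set)) \<and>
    mat_eval (*) v f ** mat_eval (*) v (C x y) \<noteq> 0"
proof -
  have UA: "unital_algebra (mat_scale (*)) (**) (mat 1 :: ('k, 'n) sqmat)"
    by (rule unital_algebra_mat[OF ring_algebra_field])
  obtain x y where ord: "f \<in> ordinary_polys"
    and "f * C x y \<notin> (neutral_identities ds \<gamma>)"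
    using assms(1) unfolding A_good_def Let_def C_def by blast
  moreover have "f * C x y \<in> ordinary_polys"
    unfolding C_def by (intro ordinary_polys_mult ord capelli_ordinary)
  ultimately obtain v where "\<And>z. v z \<in> (neutral_component ds \<gamma> :: ('k, 'n) sqmat set)"
    and "mat_eval (*) v (f * C x y) \<noteq> 0"
    unfolding ordinary_identities_def by blast
  then show ?thesis
    unfolding eval_mult[OF UA] by blast
qed

text \<open>
  The variables of the Capelli factor in the definition of goodness are disjoint from those of \<open>f\<close>,
  so its value can be prescribed independently of the value of \<open>f\<close>.
\<close>

lemma A_good_center:
  fixes f :: "('g::ab_group_add, 'k::field) graded_free_algebra"
    and \<gamma> :: "'n::{finite,linorder} \<Rightarrow> 'g"
    and v w :: "nat \<times> 'g \<Rightarrow> ('k, 'n) sqmat"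
  assumes "A_good ds \<gamma> f"
    and v: "\<And>z. v z \<in> neutral_component ds \<gamma>"
    and w: "\<And>z. w z \<in> neutral_component ds \<gamma>"
    and "mat_eval (*) v f ** mat_eval (*) w (capelli (capelli_rank TYPE('k) ds \<gamma> - 1) x y) \<noteq> 0"
  shows "mat_eval (*) v f \<in> center (neutral_component ds \<gamma>)"
proof -
  have UA: "unital_algebra (mat_scale (*)) (**) (mat 1 :: ('k, 'n) sqmat)"
    by (rule unital_algebra_mat[OF ring_algebra_field])
  define r where "r = capelli_rank TYPE('k) ds \<gamma> - 1"
  obtain x' y' where fresh: "capelli_fresh r x' y' (vars f)"
    and good: "\<And>v. (\<And>z. v z \<in> neutral_component ds \<gamma>) \<Longrightarrow>
      mat_eval (*) v (f * capelli r x' y') \<noteq> 0 \<Longrightarrow> mat_eval (*) v f \<in> center (neutral_component ds \<gamma>)"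
    using assms(1) unfolding A_good_def Let_def r_def[symmetric] by blast
  have inj: "inj_on x' {1..r}" "inj_on y' {1..Suc r}" "x' ` {1..r} \<inter> y' ` {1..Suc r} = {}"
    and disj: "((x' ` {1..r} \<union> y' ` {1..Suc r}) \<times> {0}) \<inter> vars f = {}"
    using fresh by (simp_all add: capelli_fresh_def)
  \<comment> \<open>\<open>v'\<close> keeps \<open>v\<close> on the variables of \<open>f\<close>
    and carries the values of \<open>w\<close> over to the Capelli variables \<open>x'\<close>,
    \<open>y'\<close>. All remaining variables also get values of \<open>w\<close>, so
    \<open>v'\<close> stays in the neutral component.\<close>
  define v' where "v' = (\<lambda>z.
    if z \<in> vars f then v z
    else if fst z \<in> x' ` {1..r} then w (x (the_inv_into {1..r} x' (fst z)), 0)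
    else w (y (the_inv_into {1..Suc r} y' (fst z)), 0))"
  have v': "v' z \<in> neutral_component ds \<gamma>" for z
    by (simp add: v'_def v w)
  have "mat_eval (*) v' f = mat_eval (*) v f"
    by (rule eval_cong) (simp add: v'_def)
  moreover have "mat_eval (*) v' (capelli r x' y') = mat_eval (*) w (capelli r x y)"
  proof (rule eval_capelli_cong[OF UA])
    fix i assume i: "i \<in> {1..r}"
    then have "(x' i, 0) \<notin> vars f" using disj by blast
    then show "v' (x' i, 0) = w (x i, 0)"
      using the_inv_into_f_f[OF inj(1) i] i by (simp add: v'_def)
  next
    fix i assume i: "i \<in> {1..Suc r}"
    then have "(y' i, 0) \<notin> vars f" "y' i \<notin> x' ` {1..r}" using disj inj(3) by blast+
    then show "v' (y' i, 0) = w (y i, 0)"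
      using the_inv_into_f_f[OF inj(2) i] by (simp add: v'_def)
  qed
  ultimately show ?thesis
    using good[of v', OF v'] assms(4) by (simp add: eval_mult[OF UA] r_def)
qed

text \<open>This is the value of \<open>f\<^sup>h\<close>: each monomial of \<open>f\<close>
  contains the first variable exactly once, so its second factor is \<open>b\<close>.\<close>

lemma eval_linear_substitution:
  assumes B: "ring_algebra s"
    and f: "multilinear_in ((\<lambda>j. (j, 0)) ` {1..m}) f" "1 \<le> (m::nat)"
    and v: "\<And>j. j \<in> {1..m} \<Longrightarrow> v (T j) = tensor s (a (j, 0)) (if j = 1 then b else 1)"
  shows "mat_eval s v (subst (\<lambda>(j, _). Var (T j)) f) = tensor s (mat_eval (*) a f) b"
proof -
  note UA = unital_algebra_mat[OF B]
  have "mat_eval s v (subst (\<lambda>(j, _). Var (T j)) f) = mat_eval s (\<lambda>(j, _). v (T j)) f"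
    by (simp add: eval_subst[OF UA] eval_Var[OF UA] case_prod_unfold)
  also have "\<dots> = tensor s (mat_eval (*) a f) b"
  proof (rule eval_tensor_constant_right[OF B, where b = "\<lambda>(j, _). if j = 1 then b else 1"])
    fix z assume "z \<in> vars f"
    then obtain j where "z = (j, 0)" "j \<in> {1..m}"
      using f(1) by (fastforce simp: vars_def multilinear_in_def)
    then show "(case z of (j, _) \<Rightarrow> v (T j)) =
        tensor s (a z) (case z of (j, _) \<Rightarrow> if j = 1 then b else 1)"
      using v by simp
  next
    fix w assume "w \<in> Poly_Mapping.keys f"
    then have w: "distinct (letters w)" "set (letters w) = (\<lambda>j. (j, 0)) ` {1..m}"
      using f(1) by (auto simp: multilinear_in_def)
    \<comment> \<open>\<open>distinct\<close> allows at most one factor \<open>b\<close>, and with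
      all degrees zero \<open>(1, 0)\<close> is the only letter of index 1.\<close>
    have "foldr (\<lambda>z. (*) (case z of (j, _) \<Rightarrow> if j = 1 then b else 1)) zs 1 =
        (if (1, 0) \<in> set zs then b else 1)"
      if "distinct zs" "set zs \<subseteq> UNIV \<times> {0}" for zs :: "(nat \<times> 'c) list"
      using that by (induction zs) (auto split: if_splits)
    from this[OF w(1)] show "monomial_value (*) 1 (\<lambda>(j, _). if j = 1 then b else 1) w = b"
      using w(2) f(2) by (auto simp: monomial_value_def)
  qed
  finally show ?thesis .
qed

theorem proposition3:
  fixes ds :: "nat list"
    and \<gamma> :: "'n::{finite,linorder} \<Rightarrow> 'g::ab_group_add"
    and s :: "'k::{alg_closed_field,field_char_0} \<Rightarrow> 'b::ring_1 \<Rightarrow> 'b"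
    and \<Gamma> :: "'g \<Rightarrow> 'b set"
    and f g :: "('g, 'k) graded_free_algebra"
    and h :: "nat \<Rightarrow> 'g"
    and S :: "nat \<Rightarrow> nat \<Rightarrow> nat \<times> 'g"
    and x y :: "nat \<Rightarrow> nat"
  defines "H \<equiv> supp \<Gamma>"
    and "t \<equiv> capelli_rank TYPE('k) ds \<gamma>"
    and "F \<equiv> \<lambda>i. subst (\<lambda>(j, _). Var (S i j)) f"
  defines "G \<equiv> subst (\<lambda>(i, _). F i) g"
  assumes "block_sizes TYPE('n) ds"
    and "graded_division_algebra s \<Gamma>"
    and "supp (elementary_grading ds \<gamma> :: 'g \<Rightarrow> (('k, 'n) sqmat) set) \<inter> H = {0}"
    and "1 \<le> m"
    and "multilinear_in ((\<lambda>j. (j, 0)) ` {1..m}) f"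
    and "A_good ds \<gamma> f"
    and "\<forall>i\<in>{1..u}. h i \<in> H"
    and "\<forall>i\<in>{1..u}. \<forall>j\<in>{1..m}. snd (S i j) = (if j = 1 then h i else 0)"
    and "inj_on (\<lambda>(i, j). S i j) ({1..u} \<times> {1..m})"
    and "multilinear_in ((\<lambda>i. (i, h i)) ` {1..u}) g"
    and "capelli_fresh (t - 1) x y (vars G)"
  shows "graded_identity (ring_eval s) \<Gamma> g \<longleftrightarrow>
    graded_identity (mat_eval s) (tensor_grading ds \<gamma> s \<Gamma>) (G * capelli (t - 1) x y)"
proof -
  have B: "ring_algebra s" and "is_grading s \<Gamma>"
    using assms(6) by (simp_all add: graded_division_algebra_def)
  interpret B: unital_algebra s "(*)" 1 by (rule B)
  have sub: "\<And>d. B.subspace (\<Gamma> d)"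
    using \<open>is_grading s \<Gamma>\<close> by (simp add: is_grading_def)
  have UA: "unital_algebra (mat_scale (*)) (**) (mat 1 :: ('k, 'n) sqmat)"
    by (rule unital_algebra_mat[OF ring_algebra_field])
  interpret M: unital_algebra "mat_scale s" "(**)" "mat 1 :: ('b, 'n) sqmat"
    by (rule unital_algebra_mat[OF B])
  note MA = M.unital_algebra_axioms
  let ?N = "neutral_component ds \<gamma> :: ('k, 'n) sqmat set"
  have zero_N: "0 \<in> ?N"
    by (simp add: elementary_grading_iff)
  have zero_H: "0 \<in> supp \<Gamma>"
    using assms(7) unfolding H_def by blast
  have one: "1 \<in> \<Gamma> 0"
    by (rule graded_division_algebra_one[OF assms(6) zero_H])
  have h: "h i \<in> supp \<Gamma>" if "i \<in> {1..u}" for i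
    using assms(11) that unfolding H_def by blast
  have deg: "snd (S i j) = (if j = 1 then h i else 0)" if "i \<in> {1..u}" "j \<in> {1..m}" for i j
    using assms(12) that by blast
  have g_vars: "\<exists>i\<in>{1..u}. z = (i, h i)" if "z \<in> vars g" for z
    using that assms(14) by (fastforce simp: vars_def multilinear_in_def)
  have g_keys: "distinct (letters w)" "set (letters w) = (\<lambda>i. (i, h i)) ` {1..u}"
    if "w \<in> Poly_Mapping.keys g" for w
    using that assms(14) by (auto simp: multilinear_in_def)
  have G_eval: "mat_eval s v G = mat_eval s (\<lambda>z. mat_eval s v (F (fst z))) g" for v :: "_ \<Rightarrow> ('b, 'n) sqmat"
    unfolding G_def by (simp add: eval_subst[OF MA] case_prod_unfold)
  have F_eval: "mat_eval s v (F i) = tensor s (mat_eval (*) a f) b"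
    if "\<And>j. j \<in> {1..m} \<Longrightarrow> v (S i j) = tensor s (a (j, 0)) (if j = 1 then b else 1)"
    for v :: "_ \<Rightarrow> ('b, 'n) sqmat" and i a b
    unfolding F_def by (rule eval_linear_substitution[OF B assms(9,8)]) (rule that)
  have cap_eval: "mat_eval s v (capelli r x y) = tensor s (mat_eval (*) c (capelli r x y)) 1"
    if "\<And>i. i \<in> {1..r} \<Longrightarrow> v (x i, 0) = tensor s (c (x i, 0)) 1"
      and "\<And>i. i \<in> {1..Suc r} \<Longrightarrow> v (y i, 0) = tensor s (c (y i, 0)) 1"
    for v :: "nat \<times> 'g \<Rightarrow> ('b, 'n) sqmat" and c :: "nat \<times> 'g \<Rightarrow> ('k, 'n) sqmat" and r x y
  proof -
    have "mat_eval s v (capelli r x y) = mat_eval s (\<lambda>z. tensor s (c z) 1) (capelli r x y)"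
      using that by (rule eval_capelli_cong[OF MA])
    also have "\<dots> = tensor s (mat_eval (*) c (capelli r x y)) 1"
    proof (rule eval_tensor_constant_right[OF B, where b = "\<lambda>_. 1"])
      fix w :: "(nat \<times> 'g) free_monoid"
      have "foldr (\<lambda>z. (*) (1::'b)) zs 1 = 1" for zs :: "(nat \<times> 'g) list"
        by (induction zs) simp_all
      then show "monomial_value (*) 1 (\<lambda>_. 1::'b) w = 1"
        by (simp add: monomial_value_def)
    qed simp
    finally show ?thesis .
  qed
  show ?thesis
  proof
    assume g: "graded_identity (ring_eval s) \<Gamma> g"
    show "graded_identity (mat_eval s) (tensor_grading ds \<gamma> s \<Gamma>) (G * capelli (t - 1) x y)"
      unfolding graded_identity_def
    proof (intro allI impI)
      fix v :: "nat \<times> 'g \<Rightarrow> ('b, 'n) sqmat"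
      assume v: "\<forall>i d. v (i, d) \<in> tensor_grading ds \<gamma> s \<Gamma> d"
      \<comment> \<open>Generators of the components are chosen with \<open>\<beta> 0 = 1\<close>,
        so that variables of degree 0 contribute 1 in the second factor. Off the support 0
        serves.\<close>
      have "\<exists>\<beta>. \<beta> \<in> \<Gamma> d \<and> (d \<in> supp \<Gamma> \<longrightarrow> (\<forall>b\<in>\<Gamma> d. \<exists>c. b = s c \<beta>)) \<and> (d = 0 \<longrightarrow> \<beta> = 1)" for d
      proof (cases "d \<in> supp \<Gamma>")
        case True
        then obtain \<beta> where \<beta>: "\<beta> \<in> \<Gamma> d" "\<And>b. b \<in> \<Gamma> d \<Longrightarrow> \<exists>c. b = s c \<beta>"
          using graded_division_algebra_line[OF assms(6)] by blast
        show ?thesis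
        proof (cases "d = 0")
          case True
          then obtain c where c: "1 = s c \<beta>"
            using \<beta> one by blast
          then have "c \<noteq> 0"
            by (metis B.scale_zero_left B.scale_zero_right one_neq_zero)
          then have "\<beta> = s (inverse c) 1"
            by (simp add: c)
          then have "\<exists>c'. b = s c' 1" if "b \<in> \<Gamma> d" for b
            using \<beta>(2)[OF that] by (metis B.scale_scale)
          then show ?thesis
            using True one by blast
        qed (use \<beta> in blast)
      next
        case False
        then show ?thesis
          using B.subspace_0[OF sub] zero_H by blast
      qed
      then obtain \<beta> where \<beta>: "\<And>d. \<beta> d \<in> \<Gamma> d" "\<beta> 0 = 1"
        "\<And>d b. d \<in> supp \<Gamma> \<Longrightarrow> b \<in> \<Gamma> d \<Longrightarrow> \<exists>c. b = s c (\<beta> d)"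
        by metis
      \<comment> \<open>Variables of degree outside the support get the dummy 0; those in the sets
        \<open>S i\<close> and in the Capelli polynomial have degree in the support.\<close>
      have "\<exists>a. a \<in> ?N \<and> (snd z \<in> supp \<Gamma> \<longrightarrow> v z = tensor s a (\<beta> (snd z)))" for z
      proof (cases "snd z \<in> supp \<Gamma>")
        case True
        have "v z \<in> tensor_grading ds \<gamma> s \<Gamma> (snd z)"
          using v by (metis prod.collapse)
        then show ?thesis
          using tensor_grading_supp[OF assms(6) assms(7)[unfolded H_def] True \<beta>(3)[OF True]]
          by blast
      qed (use zero_N in blast)
      then obtain a where a: "\<And>z. a z \<in> ?N" "\<And>z. snd z \<in> supp \<Gamma> \<Longrightarrow> v z = tensor s (a z) (\<beta> (snd z))"
        by metis
      define C where "C = mat_eval (*) a (capelli (t - 1) x y)"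
      have cap: "mat_eval s v (capelli (t - 1) x y) = tensor s C 1"
        unfolding C_def using zero_H by (intro cap_eval) (simp_all add: a(2) \<beta>(2))
      \<comment> \<open>The first factor of the value of \<open>F i\<close>, indexed by the
        variables of \<open>g\<close> so that monomials of \<open>g\<close> can be evaluated at
        it.\<close>
      define \<phi> where "\<phi> z = mat_eval (*) (\<lambda>(j, _). a (S (fst z) j)) f" for z :: "nat \<times> 'g"
      have \<phi>_N: "\<phi> z \<in> ?N" for z
        unfolding \<phi>_def by (rule eval_neutral_component) (simp add: case_prod_unfold a(1))
      have F: "mat_eval s v (F (fst z)) = tensor s (\<phi> z) (\<beta> (snd z))" if "z \<in> vars g" for z
      proof -
        obtain i where i: "i \<in> {1..u}" "z = (i, h i)"
          using g_vars[OF \<open>z \<in> vars g\<close>] by blast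
        then have "v (S i j) = tensor s (a (S i j)) (if j = 1 then \<beta> (h i) else 1)" if "j \<in> {1..m}" for j
          using that deg[OF i(1) that] h[OF i(1)] zero_H a(2)[of "S i j"] \<beta>(2) by (simp split: if_splits)
        then show ?thesis
          unfolding \<phi>_def i(2) fst_conv snd_conv by (intro F_eval) simp
      qed
      have good: "\<phi> z ** C = 0 \<or> \<phi> z \<in> center ?N" for z
        using A_good_center[OF assms(10), of "\<lambda>(j, _). a (S (fst z) j)" a x y]
        by (auto simp: a(1) \<phi>_def C_def t_def case_prod_unfold)
      \<comment> \<open>By multilinearity every \<open>\<phi> (i, h i)\<close> occurs in every
        monomial: one annihilating value makes \<open>D = 0\<close>; otherwise all are central and
        the order of the factors is immaterial.\<close>
      have "\<exists>D. \<forall>w\<in>Poly_Mapping.keys g. monomial_value (**) (mat 1) \<phi> w ** C = D"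
      proof (cases "\<exists>i\<in>{1..u}. \<phi> (i, h i) ** C = 0")
        case True
        then obtain i where i: "i \<in> {1..u}" "\<phi> (i, h i) ** C = 0"
          by blast
        have "monomial_value (**) (mat 1) \<phi> w ** C = 0" if "w \<in> Poly_Mapping.keys g" for w
          by (rule monomial_value_annihilates[OF \<phi>_N good, of "(i, h i)"])
            (use i g_keys(2)[OF that] in auto)
        then show ?thesis
          by blast
      next
        case False
        then have "\<phi> p \<in> center ?N" if "p \<in> (\<lambda>i. (i, h i)) ` {1..u}" for p
          using good that by blast
        then have comm: "\<phi> p ** \<phi> q = \<phi> q ** \<phi> p" if "p \<in> (\<lambda>i. (i, h i)) ` {1..u}" for p q
          using that \<phi>_N[of q] by (simp add: center_def)
        have "monomial_value (**) (mat 1) \<phi> w = monomial_value (**) (mat 1) \<phi> w'"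
          if "w \<in> Poly_Mapping.keys g" "w' \<in> Poly_Mapping.keys g" for w w'
          by (rule monomial_value_commuting[OF UA comm g_keys[OF that(1)] g_keys[OF that(2)]])
        then show ?thesis
          by metis
      qed
      then obtain D where D: "\<And>w. w \<in> Poly_Mapping.keys g \<Longrightarrow> monomial_value (**) (mat 1) \<phi> w ** C = D"
        by blast
      have "mat_eval s v (G * capelli (t - 1) x y) = tensor s D (ring_eval s (\<lambda>z. \<beta> (snd z)) g)"
        unfolding eval_mult[OF MA] cap G_eval
        by (rule eval_tensor_constant_left[OF B F D])
      also have "ring_eval s (\<lambda>z. \<beta> (snd z)) g = 0"
        using g \<beta>(1) by (simp add: graded_identity_def)
      finally show "mat_eval s v (G * capelli (t - 1) x y) = 0"
        by (simp add: tensor_def vec_eq_iff)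
    qed
  next
    assume R: "graded_identity (mat_eval s) (tensor_grading ds \<gamma> s \<Gamma>) (G * capelli (t - 1) x y)"
    show "graded_identity (ring_eval s) \<Gamma> g"
      unfolding graded_identity_def
    proof (intro allI impI)
      fix b :: "nat \<times> 'g \<Rightarrow> 'b"
      assume b: "\<forall>i d. b (i, d) \<in> \<Gamma> d"
      \<comment> \<open>The witness comes with its own Capelli variables \<open>x'\<close>,
        \<open>y'\<close>; \<open>v2\<close> below transfers its values to \<open>x\<close>,
        \<open>y\<close>.\<close>
      obtain a x' y' where all: "\<forall>z. a z \<in> ?N"
        and nonzero: "mat_eval (*) a f ** mat_eval (*) a (capelli (t - 1) x' y') \<noteq> 0"
        using A_good_witness[OF assms(10), folded t_def] by (elim exE conjE)
      note a = all[rule_format]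
      define z where "z = mat_eval (*) a f"
      define C where "C = mat_eval (*) a (capelli (t - 1) x' y')"
      have "z \<in> center ?N"
        unfolding z_def by (rule A_good_center[OF assms(10) a a nonzero[unfolded t_def]])
      then have diag: "\<And>i j. i \<noteq> j \<Longrightarrow> z $ i $ j = 0"
        by (rule center_neutral_component_diagonal)
      obtain k l where kl: "(z ** C) $ k $ l \<noteq> 0"
        using nonzero by (auto simp: z_def C_def vec_eq_iff)
      \<comment> \<open>For a one-letter word the row scaling says that the entry of
        \<open>z ** C\<close> is the product of these two scalars.\<close>
      have zC: "z $ k $ k \<noteq> 0" "C $ k $ l \<noteq> 0"
        using monomial_value_diagonal[OF diag, of "Word [()]" "\<lambda>_. z" C k l] kl
        by (auto simp: monomial_value_def)
      \<comment> \<open>This is \<open>z\<^sup>u C\<close>, where \<open>u\<close> is the common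
        length of the monomials of \<open>g\<close>.\<close>
      define D where "D = (\<chi> i j. z $ i $ i ^ u * C $ i $ j)"
      have D: "monomial_value (**) (mat 1) (\<lambda>_. z) w ** C = D" if "w \<in> Poly_Mapping.keys g" for w
      proof -
        have "length (letters w) = card ((\<lambda>i. (i, h i)) ` {1..u})"
          using g_keys[OF that] by (metis distinct_card)
        also have "\<dots> = u"
          by (subst card_image) (auto simp: inj_on_def)
        finally show ?thesis
          by (simp add: vec_eq_iff D_def monomial_value_diagonal[OF diag])
      qed
      have fresh: "inj_on x {1..t - 1}" "inj_on y {1..Suc (t - 1)}"
        "x ` {1..t - 1} \<inter> y ` {1..Suc (t - 1)} = {}"
        "((x ` {1..t - 1} \<union> y ` {1..Suc (t - 1)}) \<times> {0}) \<inter> vars G = {}"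
        using assms(15) by (simp_all add: capelli_fresh_def)
      define P where "P = {1..u} \<times> {1..m}"
      \<comment> \<open>The first variable of \<open>S i\<close> carries \<open>b (i, h i)\<close>
        and the others carry 1, unambiguously by injectivity of \<open>S\<close>. The default 0 lies
        in every component.\<close>
      define v1 where "v1 p = (if p \<in> (\<lambda>(i, j). S i j) ` P
        then case the_inv_into P (\<lambda>(i, j). S i j) p of (i, j) \<Rightarrow>
          tensor s (a (j, 0)) (if j = 1 then b (i, h i) else 1) else 0)" for p
      \<comment> \<open>In degree 0 any value of \<open>a\<close> tensored with 1 is admissible; in
        other degrees 0 is.\<close>
      define v2 where "v2 p = (if snd p \<noteq> 0 then 0
        else if fst p \<in> x ` {1..t - 1} then tensor s (a (x' (the_inv_into {1..t - 1} x (fst p)), 0)) 1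
        else tensor s (a (y' (the_inv_into {1..Suc (t - 1)} y (fst p)), 0)) 1)" for p :: "nat \<times> 'g"
      \<comment> \<open>Freshness puts the Capelli variables outside \<open>vars G\<close>, so
        \<open>v2\<close> governs them.\<close>
      define v where "v p = (if p \<in> vars G then v1 p else v2 p)" for p
      have v1: "v1 (S i j) = tensor s (a (j, 0)) (if j = 1 then b (i, h i) else 1)"
        if "i \<in> {1..u}" "j \<in> {1..m}" for i j
        using that the_inv_into_f_f[OF assms(13), of "(i, j)"]
        by (auto simp: v1_def P_def)
      have zero_R: "0 \<in> tensor_grading ds \<gamma> s \<Gamma> d" for d
        unfolding tensor_grading_def by (rule M.span_zero)
      have "v1 p \<in> tensor_grading ds \<gamma> s \<Gamma> (snd p)" for p
      proof (cases "p \<in> (\<lambda>(i, j). S i j) ` P")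
        case True
        then obtain i j where ij: "i \<in> {1..u}" "j \<in> {1..m}" "p = S i j"
          by (auto simp: P_def)
        have "v1 (S i j) \<in> tensor_grading ds \<gamma> s \<Gamma> (if j = 1 then h i else 0)"
          unfolding v1[OF ij(1,2)] by (rule tensor_in_tensor_grading[OF B a]) (simp add: b one)
        then show ?thesis
          unfolding ij(3) deg[OF ij(1,2)] .
      qed (simp add: v1_def zero_R)
      moreover have "v2 p \<in> tensor_grading ds \<gamma> s \<Gamma> (snd p)" for p
        by (auto simp: v2_def zero_R intro!: tensor_in_tensor_grading[OF B a] one)
      ultimately have "\<forall>i d. v (i, d) \<in> tensor_grading ds \<gamma> s \<Gamma> d"
        unfolding v_def by (metis snd_conv)
      then have "mat_eval s v (G * capelli (t - 1) x y) = 0"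
        using R by (simp add: graded_identity_def)
      moreover have "mat_eval s v (capelli (t - 1) x y) = tensor s C 1"
      proof -
        have "mat_eval s v (capelli (t - 1) x y) = mat_eval s (\<lambda>p. tensor s (a p) 1) (capelli (t - 1) x' y')"
        proof (rule eval_capelli_cong[OF MA])
          fix i assume i: "i \<in> {1..t - 1}"
          then have "(x i, 0) \<notin> vars G" using fresh(4) by blast
          then show "v (x i, 0) = tensor s (a (x' i, 0)) 1"
            using the_inv_into_f_f[OF fresh(1) i] i by (simp add: v_def v2_def)
        next
          fix i assume i: "i \<in> {1..Suc (t - 1)}"
          then have "(y i, 0) \<notin> vars G" "y i \<notin> x ` {1..t - 1}" using fresh(3,4) by blast+
          then show "v (y i, 0) = tensor s (a (y' i, 0)) 1"
            using the_inv_into_f_f[OF fresh(2) i] by (simp add: v_def v2_def)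
        qed
        then show ?thesis
          by (simp add: cap_eval C_def)
      qed
      moreover have "mat_eval s v G = mat_eval s (\<lambda>p. mat_eval s v1 (F (fst p))) g"
        unfolding G_eval[symmetric] by (rule eval_cong) (simp add: v_def)
      moreover have "mat_eval s v1 (F (fst p)) = tensor s z (b p)" if "p \<in> vars g" for p
      proof -
        obtain i where i: "i \<in> {1..u}" "p = (i, h i)"
          using g_vars[OF \<open>p \<in> vars g\<close>] by blast
        show ?thesis
          unfolding z_def i(2) fst_conv by (rule F_eval) (rule v1[OF i(1)])
      qed
      ultimately have "tensor s D (ring_eval s b g) = 0"
        using eval_tensor_constant_left[OF B _ D, where v = "\<lambda>p. mat_eval s v1 (F (fst p))" and b = b]
        unfolding eval_mult[OF MA] by simp
      \<comment> \<open>At this entry \<open>D\<close> is a nonzero scalar, so the value of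
        \<open>g\<close> itself must vanish.\<close>
      then have "tensor s D (ring_eval s b g) $ k $ l = 0"
        by simp
      then show "ring_eval s b g = 0"
        using zC by (simp add: tensor_def D_def)
    qed
  qed
qed

end
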